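(* Let $\pi=\text{c-Ind}_{N_G(\mathrm K(\mathfrak p))}^G(\tau)$ be a depth zero supercuspidal representation of $G=\mathrm{GSp}(4,F)$, where $\tau$ is an irreducible representation of the normalizer $N_G(\mathrm K(\mathfrak p))$ such that $\tau|_{\mathrm K(\mathfrak p)}$ is an inflation of a cuspidal representation of $\mathrm K(\mathfrak p)/\mathrm K(\mathfrak p)^+$. Then $\pi^{\mathrm{Kl}(\mathfrak p^n)}=0$ for all $n\ge0$.
   Context: $F$ is a finite extension of $\mathbb Q_p$ with ring of integers $\mathfrak o$, maximal ideal $\mathfrak p$, residue field $\mathbb F_q$. $J=\begin{bmatrix}&&&1\\&&1&\\&-1&&\\-1&&&\end{bmatrix}$, $G=\mathrm{GSp}(4,F)=\{g\in\mathrm{GL}(4,F):{}^tgJg=\mu(g)J\}$, $G^0=\{g\in G:\mu(g)\in\mathfrak o^\times\}$. The group $$\mathrm K(\mathfrak p)=\begin{bmatrix}\mathfrak o&\mathfrak o&\mathfrak o&\mathfrak p^{-1}\\ \mathfrak p&\mathfrak o&\mathfrak o&\mathfrak o\\ \mathfrak p&\mathfrak o&\mathfrak o&\mathfrak o\\ \mathfrak p&\mathfrak p&\mathfrak p&\mathfrak o\end{bmatrix}\cap G^0$$ is a maximal compact subgroup, and its pro-unipotent radical is $$\mathrm K(\mathfrak p)^+=\begin{bmatrix}1+\mathfrak p&\mathfrak o&\mathfrak o&\mathfrak o\\ \mathfrak p&1+\mathfrak p&\mathfrak p&\mathfrak o\\ \mathfrak p&\mathfrak p&1+\mathfrak p&\mathfrak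 o\\ \mathfrak p^2&\mathfrak p&\mathfrak p&1+\mathfrak p\end{bmatrix}\cap G.$$ The quotient $\mathrm K(\mathfrak p)/\mathrm K(\mathfrak p)^+$ is the group of $\mathbb F_q$-points of a connected reductive group (isomorphic to $\{(g,h)\in\mathrm{GL}(2,\mathbb F_q)^2:\det g=\det h\}$); cuspidal means having no nonzero vectors fixed by the unipotent radical of any proper parabolic subgroup. For $n\ge0$, $$\mathrm{Kl}(\mathfrak p^n)=\begin{bmatrix}\mathfrak o&\mathfrak o&\mathfrak o&\mathfrak o\\ \mathfrak p^n&\mathfrak o&\mathfrak o&\mathfrak o\\ \mathfrak p^n&\mathfrak o&\mathfrak o&\mathfrak o\\ \mathfrak p^n&\mathfrak p^n&\mathfrak p^n&\mathfrak o\end{bmatrix}\cap G^0,$$ with $\mathfrak p^0=\mathfrak o$, so $\mathrm{Kl}(\mathfrak p^0)=\mathrm{GSp}(4,\mathfrak o)$. For a subgroup $H$ and representation $\rho$ of $H$ on $W$, $\text{c-Ind}_H^G(\rho)$ is the space of smooth functions $f:G\to W$ with $f(hg)=\rho(h)f(g)$ for $h\in H$, compactly supported modulo $H$, with $G$ acting by right translation. *)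

theory Defs
  imports "HOL-Analysis.Analysis" "HOL-Algebra.Coset" "HOL-Algebra.Group_Action"
begin

section \<open>Finite extensions of \<open>\<rat>\<^sub>p\<close>\<close>

text \<open>
  The field \<open>F\<close> is a type of sort \<open>{field_char_0, metric_space}\<close>; its absolute value is the
  distance to \<open>0\<close>, so that the library topology on \<open>F\<close>, and on 4 x 4 matrices over \<open>F\<close>, is the
  \<open>p\<close>-adic one.
\<close>

definition absv :: "'a::{field_char_0, metric_space} \<Rightarrow> real" where
  "absv x = dist x 0"

text \<open>
  The normalisation \<open>|p| = 1/p\<close> forces the ultrametric absolute value to extend the \<open>p\<close>-adic
  absolute value of \<open>\<rat>\<close>. If the closure of \<open>\<rat>\<close> in \<open>F\<close> is complete, it is the completion of
  \<open>\<rat>\<close>, i.e. \<open>\<rat>\<^sub>p\<close>. The last clause says that \<open>F\<close> has finite dimension over it. The absolute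
  value on a finite extension of \<open>\<rat>\<^sub>p\<close> is unique, so it is no additional datum.
\<close>

definition finite_extension_of_Qp :: "nat \<Rightarrow> 'a::{field_char_0, metric_space} itself \<Rightarrow> bool" where
  "finite_extension_of_Qp p (_ :: 'a itself) \<longleftrightarrow>
     prime p \<and>
     (\<forall>x y :: 'a. dist x y = absv (x - y)) \<and>
     (\<forall>x y :: 'a. absv (x * y) = absv x * absv y) \<and>
     (\<forall>x y :: 'a. absv (x + y) \<le> max (absv x) (absv y)) \<and>
     absv (of_nat p :: 'a) = 1 / real p \<and>
     complete (closure (\<rat> :: 'a set)) \<and>
     (\<exists>B :: 'a set. finite B \<and>
        (\<forall>x. \<exists>c. (\<forall>b\<in>B. c b \<in> closure \<rat>) \<and> x = (\<Sum>b\<in>B. c b * b)))"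

definition int_ring :: "'a::{field_char_0, metric_space} set" where
  "int_ring = {x. absv x \<le> 1}"

definition int_units :: "'a::{field_char_0, metric_space} set" where
  "int_units = {x \<in> int_ring. x \<noteq> 0 \<and> inverse x \<in> int_ring}"

definition max_ideal :: "'a::{field_char_0, metric_space} set" where
  "max_ideal = {x. absv x < 1}"

definition uniformizer :: "'a::{field_char_0, metric_space} \<Rightarrow> bool" where
  "uniformizer w \<longleftrightarrow> w \<noteq> 0 \<and> max_ideal = (*) w ` int_ring"

text \<open>The fractional ideal \<open>\<pp>\<^sup>k\<close>; it does not depend on the uniformizer.\<close>

definition frac_ideal :: "int \<Rightarrow> 'a::{field_char_0, metric_space} set" where
  "frac_ideal k = {w powi k * y | w y. uniformizer w \<and> y \<in> int_ring}"


section \<open>The group \<open>GSp(4,F)\<close> and its subgroups\<close>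

text \<open>Matrix rows and columns are indexed by the numeral type \<open>4\<close>, in the order 1, 2, 3, 4 (= 0).\<close>

lemma vector_4 [simp]:
  "(vector [a, b, c, d] :: 'a::zero^4) $ 1 = a"
  "(vector [a, b, c, d] :: 'a::zero^4) $ 2 = b"
  "(vector [a, b, c, d] :: 'a::zero^4) $ 3 = c"
  "(vector [a, b, c, d] :: 'a::zero^4) $ 4 = d"
  unfolding vector_def by auto

definition Jmat :: "'a::field^4^4" where
  "Jmat = vector [vector [0, 0, 0, 1],
                  vector [0, 0, 1, 0],
                  vector [0, -1, 0, 0],
                  vector [-1, 0, 0, 0]]"

definition GSp4 :: "('a::field^4^4) monoid" where
  "GSp4 = \<lparr>carrier = {g. invertible g \<and> (\<exists>m. transpose g ** Jmat ** g = mat m ** Jmat)},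
           mult = (**), one = mat 1\<rparr>"

definition multiplier :: "'a::field^4^4 \<Rightarrow> 'a" where
  "multiplier g = (THE m. transpose g ** Jmat ** g = mat m ** Jmat)"

definition GSp4_0 :: "('a::{field_char_0, metric_space}^4^4) set" where
  "GSp4_0 = {g \<in> carrier GSp4. multiplier g \<in> int_units}"

text \<open>Matrices whose \<open>(i,j)\<close> entry lies in \<open>\<pp>\<close> to the power \<open>E\<^sub>i\<^sub>j\<close>.\<close>

definition entries_in :: "int^4^4 \<Rightarrow> ('a::{field_char_0, metric_space}^4^4) set" where
  "entries_in E = {g. \<forall>i j. g $ i $ j \<in> frac_ideal (E $ i $ j)}"

definition Kpara :: "('a::{field_char_0, metric_space}^4^4) set" where
  "Kpara = entries_in (vector [vector [0, 0, 0, -1],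
                               vector [1, 0, 0, 0],
                               vector [1, 0, 0, 0],
                               vector [1, 1, 1, 0]]) \<inter> GSp4_0"

definition Kpara_plus :: "('a::{field_char_0, metric_space}^4^4) set" where
  "Kpara_plus = {g. g - mat 1 \<in> entries_in (vector [vector [1, 0, 0, 0],
                                                    vector [1, 1, 1, 0],
                                                    vector [1, 1, 1, 0],
                                                    vector [2, 1, 1, 1]])} \<inter> carrier GSp4"

definition Klingen :: "nat \<Rightarrow> ('a::{field_char_0, metric_space}^4^4) set" where
  "Klingen n = entries_in (vector [vector [0, 0, 0, 0],
                                   vector [int n, 0, 0, 0],
                                   vector [int n, 0, 0, 0],
                                   vector [int n, int n, int n, 0]]) \<inter> GSp4_0"

abbreviation Kquot :: "('a::{field_char_0, metric_space}^4^4) set monoid" where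
  "Kquot \<equiv> (GSp4\<lparr>carrier := Kpara\<rparr>) Mod Kpara_plus"

abbreviation Knormalizer :: "('a::{field_char_0, metric_space}^4^4) monoid" where
  "Knormalizer \<equiv> GSp4\<lparr>carrier := normalizer GSp4 Kpara\<rparr>"


section \<open>Parabolic subgroups of the reductive quotient\<close>

text \<open>
  The group \<open>K(\<pp>)\<close> stabilises the chain of lattices of column vectors
  \<open>L\<^sub>0 = (\<oo>,\<oo>,\<oo>,\<pp>)\<close>, \<open>L\<^sub>1 = (\<oo>,\<pp>,\<pp>,\<pp>)\<close>, \<open>L\<^sub>2 = \<pp> L\<^sub>0 = (\<pp>,\<pp>,\<pp>,\<pp>\<^sup>2)\<close>, and \<open>K(\<pp>)\<^sup>+\<close> is the subgroup
  acting trivially on the two-dimensional \<open>\<bbbF>\<^sub>q\<close>-spaces \<open>V\<^sub>1 = L\<^sub>0/L\<^sub>1\<close> (coordinates 2, 3) and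
  \<open>V\<^sub>2 = L\<^sub>1/L\<^sub>2\<close> (coordinates 1, 4). The action on \<open>V\<^sub>1\<close> and \<open>V\<^sub>2\<close> is the isomorphism of
  \<open>K(\<pp>)/K(\<pp>)\<^sup>+\<close> with \<open>{(g,h) \<in> GL(V\<^sub>1) \<times> GL(V\<^sub>2). det g = det h}\<close>.

  The (\<open>\<bbbF>\<^sub>q\<close>-points of) parabolic subgroups of the latter are the stabilisers of pairs consisting
  of a flag \<open>0 \<subseteq> A/L\<^sub>1 \<subseteq> V\<^sub>1\<close> and a flag \<open>0 \<subseteq> B/L\<^sub>2 \<subseteq> V\<^sub>2\<close>; the unipotent radical consists of the
  elements acting trivially on the graded pieces of both flags. The trivial subspaces are allowed
  for \<open>A/L\<^sub>1\<close> and \<open>B/L\<^sub>2\<close>, which gives the factors where the parabolic is everything.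
  Subspaces are represented by their preimages, the \<open>\<oo>\<close>-modules \<open>A\<close> and \<open>B\<close>.
\<close>

definition coord_lattice :: "int^4 \<Rightarrow> ('a::{field_char_0, metric_space}^4) set" where
  "coord_lattice e = {x. \<forall>i. x $ i \<in> frac_ideal (e $ i)}"

abbreviation L0 :: "('a::{field_char_0, metric_space}^4) set" where
  "L0 \<equiv> coord_lattice (vector [0, 0, 0, 1])"

abbreviation L1 :: "('a::{field_char_0, metric_space}^4) set" where
  "L1 \<equiv> coord_lattice (vector [0, 1, 1, 1])"

abbreviation L2 :: "('a::{field_char_0, metric_space}^4) set" where
  "L2 \<equiv> coord_lattice (vector [1, 1, 1, 2])"

definition int_submodule :: "('a::{field_char_0, metric_space}^4) set \<Rightarrow> bool" where
  "int_submodule A \<longleftrightarrow> 0 \<in> A \<and> (\<forall>x\<in>A. \<forall>y\<in>A. x + y \<in> A) \<and> (\<forall>c\<in>int_ring. \<forall>x\<in>A. c *s x \<in> A)"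

definition flag_pair ::
  "('a::{field_char_0, metric_space}^4) set \<Rightarrow> ('a^4) set \<Rightarrow> bool" where
  "flag_pair A B \<longleftrightarrow> int_submodule A \<and> L1 \<subseteq> A \<and> A \<subseteq> L0 \<and>
                     int_submodule B \<and> L2 \<subseteq> B \<and> B \<subseteq> L1"

definition parabolic ::
  "('a::{field_char_0, metric_space}^4) set \<Rightarrow> ('a^4) set \<Rightarrow> ('a^4^4) set set" where
  "parabolic A B =
     {Kpara_plus #>\<^bsub>GSp4\<^esub> k | k. k \<in> Kpara \<and> (*v) k ` A = A \<and> (*v) k ` B = B}"

text \<open>\<open>k\<close> acts trivially on the quotient \<open>M/N\<close>.\<close>

definition trivial_on_quotient ::
  "'a::{field_char_0, metric_space}^4^4 \<Rightarrow> ('a^4) set \<Rightarrow> ('a^4) set \<Rightarrow> bool" where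
  "trivial_on_quotient k M N \<longleftrightarrow> (\<forall>x\<in>M. k *v x - x \<in> N)"

definition unipotent_radical ::
  "('a::{field_char_0, metric_space}^4) set \<Rightarrow> ('a^4) set \<Rightarrow> ('a^4^4) set set" where
  "unipotent_radical A B =
     {Kpara_plus #>\<^bsub>GSp4\<^esub> k | k. k \<in> Kpara \<and>
        trivial_on_quotient k L0 A \<and> trivial_on_quotient k A L1 \<and>
        trivial_on_quotient k L1 B \<and> trivial_on_quotient k B L2}"


section \<open>Representations\<close>

text \<open>
  A complex vector space \<open>W\<close> is an additive group type with a scalar multiplication \<open>smul\<close>.
  Only the values of \<open>\<rho>\<close> on the carrier of \<open>H\<close> matter.
\<close>

definition representation ::
  "(complex \<Rightarrow> 'w::ab_group_add \<Rightarrow> 'w) \<Rightarrow> ('g, 'm) monoid_scheme \<Rightarrow> ('g \<Rightarrow> 'w \<Rightarrow> 'w) \<Rightarrow> bool" where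
  "representation smul H \<rho> \<longleftrightarrow>
     vector_space smul \<and>
     (\<forall>h\<in>carrier H. Vector_Spaces.linear smul smul (\<rho> h)) \<and>
     (\<forall>w. \<rho> \<one>\<^bsub>H\<^esub> w = w) \<and>
     (\<forall>g\<in>carrier H. \<forall>h\<in>carrier H. \<forall>w. \<rho> (g \<otimes>\<^bsub>H\<^esub> h) w = \<rho> g (\<rho> h w))"

definition irreducible_representation ::
  "(complex \<Rightarrow> 'w::ab_group_add \<Rightarrow> 'w) \<Rightarrow> ('g, 'm) monoid_scheme \<Rightarrow> ('g \<Rightarrow> 'w \<Rightarrow> 'w) \<Rightarrow> bool" where
  "irreducible_representation smul H \<rho> \<longleftrightarrow>
     representation smul H \<rho> \<and>
     (UNIV :: 'w set) \<noteq> {0} \<and>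
     (\<forall>S. module.subspace smul S \<and> (\<forall>h\<in>carrier H. \<rho> h ` S \<subseteq> S) \<longrightarrow> S = {0} \<or> S = UNIV)"

definition fixed_vectors :: "'v set \<Rightarrow> ('g \<Rightarrow> 'v \<Rightarrow> 'v) \<Rightarrow> 'g set \<Rightarrow> 'v set" where
  "fixed_vectors V act U = {v \<in> V. \<forall>u\<in>U. act u v = v}"

definition cuspidal ::
  "(complex \<Rightarrow> 'w::ab_group_add \<Rightarrow> 'w) \<Rightarrow>
   (('a::{field_char_0, metric_space}^4^4) set \<Rightarrow> 'w \<Rightarrow> 'w) \<Rightarrow> bool" where
  "cuspidal smul \<sigma> \<longleftrightarrow>
     representation smul (Kquot :: ('a^4^4) set monoid) \<sigma> \<and>
     (\<forall>A B. flag_pair A B \<and> parabolic A B \<noteq> carrier Kquot \<longrightarrow>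
        fixed_vectors UNIV \<sigma> (unipotent_radical A B) = {0})"

text \<open>
  The space of the compactly induced representation. Functions on \<open>G\<close> are extended by zero to the
  ambient type.
\<close>

definition c_Ind ::
  "('g::topological_space, 'm) monoid_scheme \<Rightarrow> 'g set \<Rightarrow> ('g \<Rightarrow> 'w::zero \<Rightarrow> 'w) \<Rightarrow> ('g \<Rightarrow> 'w) set" where
  "c_Ind G H \<rho> = {f.
     (\<forall>g. g \<notin> carrier G \<longrightarrow> f g = 0) \<and>
     (\<forall>h\<in>H. \<forall>g\<in>carrier G. f (h \<otimes>\<^bsub>G\<^esub> g) = \<rho> h (f g)) \<and>
     (\<exists>U. subgroup U G \<and> openin (top_of_set (carrier G)) U \<and>
        (\<forall>g\<in>carrier G. \<forall>u\<in>U. f (g \<otimes>\<^bsub>G\<^esub> u) = f g)) \<and>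
     (\<exists>C. C \<subseteq> carrier G \<and> compact C \<and> {g \<in> carrier G. f g \<noteq> 0} \<subseteq> H <#>\<^bsub>G\<^esub> C)}"

definition right_translation ::
  "('g, 'm) monoid_scheme \<Rightarrow> 'g \<Rightarrow> ('g \<Rightarrow> 'w::zero) \<Rightarrow> 'g \<Rightarrow> 'w" where
  "right_translation G g f = (\<lambda>x. if x \<in> carrier G then f (x \<otimes>\<^bsub>G\<^esub> g) else 0)"

end

theory Submission
  imports Defs "HOL-Algebra.Zassenhaus"
begin

text \<open>
  Let \<open>f\<close> be a fixed vector and \<open>g \<in> G\<close>. The transvections along \<open>e\<^sub>2\<close> and \<open>e\<^sub>3\<close> with integral
  coefficient lie in \<open>Kl(\<pp>\<^sup>n)\<close> for every \<open>n\<close>, and \<open>g\<close> conjugates them into transvections along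
  \<open>g e\<^sub>2\<close> and \<open>g e\<^sub>3\<close>. Since \<open>\<langle>g e\<^sub>2, g e\<^sub>3\<rangle> = \<mu>(g)\<close>, for at least one of these two columns, which is
  \<open>w\<^sup>k v\<close> with \<open>w\<close> a uniformizer and \<open>v\<close> in \<open>L\<^sub>0 - L\<^sub>1\<close> or \<open>L\<^sub>1 - L\<^sub>2\<close>, the conjugates include all transvections
  \<open>x \<mapsto> x + c \<langle>x, v\<rangle> v\<close> (with \<open>c \<in> \<oo>\<close> in the first case and \<open>c \<in> \<pp>\<^sup>-\<^sup>1\<close> in the second). These lie in
  \<open>K(\<pp>)\<close>, and modulo \<open>K(\<pp>)\<^sup>+\<close> they are the unipotent radical of the stabiliser of the line
  spanned by \<open>v\<close> in \<open>L\<^sub>0/L\<^sub>1\<close> or \<open>L\<^sub>1/L\<^sub>2\<close>. So \<open>f(g)\<close> is fixed by this unipotent radical, and it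
  vanishes by cuspidality.
\<close>

section \<open>Discreteness of the absolute value\<close>

text \<open>\<open>field\<close> pins down the type \<open>'a\<close>; the absolute value itself is
  determined by the metric.\<close>

locale nonarch_absv =
  fixes field :: "'a::{field_char_0, metric_space} itself"
  assumes dist_eq: "dist x y = absv (x - y :: 'a)"
    and absv_mult: "absv (x * y :: 'a) = absv x * absv y"
    and absv_add: "absv (x + y :: 'a) \<le> max (absv x) (absv y)"
begin

section \<open>Elementary properties of an ultrametric absolute value\<close>

lemma absv_eq_0 [simp]: "absv (x :: 'a) = 0 \<longleftrightarrow> x = 0"
  by (simp add: absv_def)

lemma absv_0 [simp]: "absv (0 :: 'a) = 0"
  by simp

lemma absv_nonneg [simp]: "0 \<le> absv (x :: 'a)"
  by (simp add: absv_def)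

lemma absv_1 [simp]: "absv (1 :: 'a) = 1"
  using absv_mult[of 1 1] absv_eq_0[of 1] by simp

lemma absv_minus [simp]: "absv (- x :: 'a) = absv x"
proof -
  have "(absv (-1 :: 'a))\<^sup>2 = 1"
    using absv_mult[of "-1" "-1"] by (simp add: power2_eq_square)
  then have "absv (-1 :: 'a) = 1"
    using absv_nonneg[of "-1"] by (simp add: power2_eq_1_iff)
  then show ?thesis
    using absv_mult[of "-1" x] by simp
qed

lemma absv_inverse: "absv (inverse x :: 'a) = inverse (absv x)"
proof (cases "x = 0")
  case False
  then show ?thesis
    using absv_mult[of x "inverse x"] by (simp add: field_simps)
qed (simp add: absv_def)

lemma absv_divide: "absv (x / y :: 'a) = absv x / absv y"
  by (simp add: divide_inverse absv_mult absv_inverse)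

lemma absv_power: "absv (x ^ n :: 'a) = absv x ^ n"
  by (induction n) (simp_all add: absv_mult)

lemma absv_powi: "absv (x powi k :: 'a) = absv x powi k"
  by (simp add: power_int_def absv_power absv_inverse)

lemma absv_diff_commute: "absv (x - y :: 'a) = absv (y - x)"
  using absv_minus[of "x - y"] by simp

lemma absv_of_nat: "absv (of_nat n :: 'a) \<le> 1"
proof (induction n)
  case (Suc n)
  then show ?case
    using absv_add[of "of_nat n" 1] by (simp add: add.commute)
qed simp

lemma absv_of_int: "absv (of_int n :: 'a) \<le> 1"
  by (cases n rule: int_cases2) (simp_all add: absv_of_nat)

text \<open>The ultrametric isosceles principle: \<open>x\<close> and \<open>y\<close> are each
  bounded through the other and \<open>x - y\<close>.\<close>

lemma absv_eq_of_close:
  assumes "absv (x - y) < absv (x :: 'a)"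
  shows "absv y = absv x"
  using absv_add[of "x - y" y] absv_add[of "y - x" x] assms absv_diff_commute[of x y]
  by (simp add: max_def split: if_splits)

lemma absv_sum_less:
  assumes "0 < r" "\<And>i. i \<in> I \<Longrightarrow> absv (f i :: 'a) < r"
  shows "absv (\<Sum>i\<in>I. f i) < r"
  using assms(2)
proof (induction I rule: infinite_finite_induct)
  case (insert i I)
  then have "max (absv (f i)) (absv (\<Sum>i\<in>I. f i)) < r"
    by simp
  with absv_add have "absv (f i + (\<Sum>i\<in>I. f i)) < r"
    by (rule le_less_trans)
  then show ?case
    using insert.hyps by simp
qed (use assms(1) in simp_all)

text \<open>A single term of strictly largest absolute value could not be cancelled by the remaining
  ones, so the maximum is attained at least twice.\<close>

lemma equal_terms_of_zero_sum:
  assumes "finite I" "(\<Sum>i\<in>I. f i :: 'a) = 0" "\<exists>i\<in>I. f i \<noteq> 0"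
  obtains i j where "i \<in> I" "j \<in> I" "i \<noteq> j" "f i \<noteq> 0" "absv (f i) = absv (f j)"
proof -
  have "Max (absv ` f ` I) \<in> absv ` f ` I"
    using assms by (intro Max_in) auto
  then obtain i where i: "i \<in> I" "absv (f i) = Max (absv ` f ` I)"
    by auto
  then have max: "absv (f j) \<le> absv (f i)" if "j \<in> I" for j
    using assms(1) that by simp
  then have pos: "0 < absv (f i)"
    using assms(3) absv_nonneg absv_eq_0 by (metis less_le less_le_trans)
  have "f i = - (\<Sum>j\<in>I - {i}. f j)"
    using assms(1,2) i(1) by (simp add: sum.remove eq_neg_iff_add_eq_0)
  then have "absv (f i) = absv (\<Sum>j\<in>I - {i}. f j)"
    by simp
  then have "\<not> (\<forall>j\<in>I - {i}. absv (f j) < absv (f i))"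
    using absv_sum_less[OF pos, of "I - {i}" f] by auto
  then obtain j where "j \<in> I - {i}" "\<not> absv (f j) < absv (f i)"
    by blast
  moreover have "f i \<noteq> 0"
    using pos by auto
  ultimately show ?thesis
    using that[of i j] i(1) max[of j] by auto
qed

text \<open>The \<open>p\<close>-part of an integer contributes a power of \<open>1/p\<close>. For
  \<open>n\<close> prime to \<open>p\<close>, Bezout gives \<open>1 = a n + b p\<close>; since
  \<open>|b p| < 1\<close>, the ultrametric inequality forces \<open>|a n|\<close>, and hence
  \<open>|n|\<close>, up to 1.\<close>

lemma absv_Rats:
  assumes p: "prime p" "absv (of_nat p :: 'a) = 1 / real p" and q: "q \<in> \<rat>" "(q :: 'a) \<noteq> 0"
  obtains k where "absv q = real p powi k"
proof -
  have p_pos: "real p > 0"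
    using prime_gt_0_nat[OF p(1)] by simp
  have coprime: "absv (of_nat n :: 'a) = 1" if "\<not> p dvd n" for n
  proof -
    have "coprime (int n) (int p)"
      using prime_imp_coprime_nat[OF p(1) that] by (simp add: coprime_commute)
    then obtain a b where "a * int n + b * int p = 1"
      using bezout_int[of "int n" "int p"] by auto
    then have "of_int a * of_nat n + of_int b * of_nat p = (1 :: 'a)"
      by (metis of_int_add of_int_mult of_int_of_nat_eq of_int_1)
    then have "1 \<le> max (absv (of_int a * of_nat n :: 'a)) (absv (of_int b * of_nat p :: 'a))"
      using absv_add[of "of_int a * of_nat n" "of_int b * of_nat p"] by simp
    moreover have "absv (of_int b * of_nat p :: 'a) \<le> 1 / real p"
      using absv_of_int[of b] p_pos by (simp add: absv_mult p(2) divide_right_mono)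
    moreover have "1 / real p < 1"
      using prime_gt_1_nat[OF p(1)] by simp
    moreover have "absv (of_int a * of_nat n :: 'a) \<le> absv (of_nat n :: 'a)"
      using absv_of_int[of a] mult_right_mono[OF _ absv_nonneg[of "of_nat n"], of _ 1] by (simp add: absv_mult)
    ultimately have "1 \<le> absv (of_nat n :: 'a)"
      by linarith
    then show ?thesis
      using absv_of_nat[of n] by simp
  qed
  have nat: "\<exists>k. absv (of_nat n :: 'a) = real p powi k" if n: "n > 0" for n
  proof -
    have "n \<noteq> 0" "\<not> is_unit p"
      using n p(1) by (auto dest: not_prime_unit)
    then obtain m where m: "n = p ^ multiplicity p n * m" "\<not> p dvd m"
      by (rule multiplicity_decompose')
    then have "absv (of_nat n :: 'a) = (1 / real p) ^ multiplicity p n"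
      by (metis absv_mult absv_power coprime mult.right_neutral of_nat_mult of_nat_power p(2))
    then have "absv (of_nat n :: 'a) = real p powi (- int (multiplicity p n))"
      by (simp add: power_int_minus power_one_over divide_inverse power_inverse)
    then show ?thesis
      by blast
  qed
  have int: "\<exists>k. absv (of_int n :: 'a) = real p powi k" if "n \<noteq> 0" for n
    using that nat by (cases n rule: int_cases2) auto
  obtain a b where ab: "b > 0" "q = of_int a / of_int b"
    using q(1) by (auto elim: Rats_cases')
  then obtain k l where "absv (of_int a :: 'a) = real p powi k" "absv (of_int b :: 'a) = real p powi l"
    using int[of a] int[of b] q(2) by auto
  then have "absv q = real p powi (k - l)"
    using p_pos by (simp add: ab absv_divide power_int_diff)
  then show ?thesis
    by (rule that)
qed

section \<open>The closure of the rationals as a valued subfield\<close>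

lemma closure_Rats_iff:
  "x \<in> closure (\<rat> :: 'a set) \<longleftrightarrow> (\<forall>e>0. \<exists>q\<in>\<rat>. absv (x - q) < e)"
  unfolding closure_approachable dist_eq absv_diff_commute[of x] ..

text \<open>A rational number closer to \<open>x\<close> than \<open>|x|\<close> has the same
  absolute value as \<open>x\<close>.\<close>

lemma absv_closure_Rats:
  assumes "x \<in> closure (\<rat> :: 'a set)" "x \<noteq> 0"
  obtains q :: 'a where "q \<in> \<rat>" "q \<noteq> 0" "absv x = absv q"
proof -
  have "0 < absv x"
    using assms(2) absv_nonneg[of x] by (simp add: less_le)
  then obtain q where "q \<in> \<rat>" "absv (x - q) < absv x"
    using assms(1) by (auto simp: closure_Rats_iff)
  moreover from this have "absv q = absv x"
    by (intro absv_eq_of_close)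
  moreover from this have "q \<noteq> 0"
    using assms(2) by (metis absv_eq_0)
  ultimately show ?thesis
    using that[of q] by simp
qed

lemma closure_Rats_add:
  assumes "x \<in> closure \<rat>" "y \<in> closure \<rat>" shows "x + y \<in> closure (\<rat> :: 'a set)"
  unfolding closure_Rats_iff
proof (intro allI impI)
  fix e :: real assume "e > 0"
  then obtain q r where qr: "q \<in> \<rat>" "r \<in> \<rat>" "absv (x - q) < e" "absv (y - r) < e"
    using assms unfolding closure_Rats_iff by blast
  then have "absv ((x + y) - (q + r)) < e"
    using absv_add[of "x - q" "y - r"] by (simp add: algebra_simps)
  then show "\<exists>q\<in>\<rat>. absv (x + y - q) < e"
    using qr Rats_add by blast
qed

lemma closure_Rats_mult:
  assumes "x \<in> closure \<rat>" "y \<in> closure \<rat>" shows "x * y \<in> closure (\<rat> :: 'a set)"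
  unfolding closure_Rats_iff
proof (intro allI impI)
  fix e :: real assume e: "e > 0"
  have pos: "0 < absv x + 1"
    using absv_nonneg[of x] by linarith
  \<comment> \<open>The estimate splits \<open>x y - q r\<close> as
    \<open>x (y - r) + (x - q) r\<close>, so \<open>r\<close> is chosen first and the tolerance for
    \<open>q\<close> depends on it. Adding 1 keeps the denominators positive.\<close>
  obtain r where r: "r \<in> \<rat>" "absv (y - r) < e / (absv x + 1)"
    using assms(2) e pos unfolding closure_Rats_iff by (metis divide_pos_pos)
  have pos': "0 < absv r + 1"
    using absv_nonneg[of r] by linarith
  obtain q where q: "q \<in> \<rat>" "absv (x - q) < e / (absv r + 1)"
    using assms(1) e pos' unfolding closure_Rats_iff by (metis divide_pos_pos)
  have "absv (y - r) * (absv x + 1) < e" "absv (x - q) * (absv r + 1) < e"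
    using q r pos pos' by (simp_all add: pos_less_divide_eq)
  then have "absv x * absv (y - r) < e" "absv (x - q) * absv r < e"
    using absv_nonneg[of "y - r"] absv_nonneg[of "x - q"]
    by (simp_all add: distrib_left mult.commute del: absv_nonneg)
  then have "absv (x * (y - r)) < e" "absv ((x - q) * r) < e"
    by (simp_all only: absv_mult)
  moreover have "x * y - q * r = x * (y - r) + (x - q) * r"
    by (simp add: algebra_simps)
  ultimately have "absv (x * y - q * r) < e"
    using absv_add[of "x * (y - r)" "(x - q) * r"] by simp
  then show "\<exists>q\<in>\<rat>. absv (x * y - q) < e"
    using q r Rats_mult by blast
qed

lemma closure_Rats_inverse:
  assumes "x \<in> closure \<rat>" shows "inverse x \<in> closure (\<rat> :: 'a set)"
proof (cases "x = 0")
  case False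
  then have pos: "0 < absv x"
    using absv_nonneg[of x] by (simp add: less_le)
  show ?thesis
    unfolding closure_Rats_iff
  proof (intro allI impI)
    fix e :: real assume "e > 0"
    \<comment> \<open>The first bound gives \<open>|q| = |x|\<close>; the second then controls the
      difference of the inverses, which has value \<open>|x - q| / |x|^2\<close>.\<close>
    then have "0 < min (absv x) (e * (absv x)\<^sup>2)"
      using pos False by simp
    then obtain q where q: "q \<in> \<rat>" "absv (x - q) < min (absv x) (e * (absv x)\<^sup>2)"
      using assms unfolding closure_Rats_iff by blast
    then have eq: "absv q = absv x"
      by (intro absv_eq_of_close) simp
    then have "q \<noteq> 0"
      using pos by auto
    then have "inverse x - inverse q = (q - x) / (x * q)"
      using False by (simp add: field_simps)
    then have "absv (inverse x - inverse q) = absv (x - q) / (absv x)\<^sup>2"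
      by (simp add: absv_divide absv_mult eq power2_eq_square absv_diff_commute[of q x])
    also have "\<dots> < e"
      using q pos False by (simp add: pos_divide_less_eq)
    finally show "\<exists>q\<in>\<rat>. absv (inverse x - q) < e"
      using q by (intro bexI[of _ "inverse q"]) auto
  qed
qed (use assms in simp)

end

text \<open>Gaussian elimination on the spanning set, which need not be independent. If some
  \<open>f k\<close> involves the generator \<open>b\<close>, subtracting multiples of it removes
  \<open>b\<close> from the other elements, and \<open>I\<close> and the spanning set both shrink by
  one. The scalars form a subset \<open>K\<close> of the ambient field because they will be the
  closure of the rationals.\<close>

lemma linear_dependence:
  fixes K :: "'a::field set" and f :: "'i \<Rightarrow> 'a"
  assumes K: "0 \<in> K" "1 \<in> K" "\<And>x y. x \<in> K \<Longrightarrow> y \<in> K \<Longrightarrow> x + y \<in> K"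
      "\<And>x y. x \<in> K \<Longrightarrow> y \<in> K \<Longrightarrow> x * y \<in> K" "\<And>x. x \<in> K \<Longrightarrow> - x \<in> K" "\<And>x. x \<in> K \<Longrightarrow> inverse x \<in> K"
    and "finite B" "finite I" "card B < card I"
    and "\<And>i. i \<in> I \<Longrightarrow> \<exists>c. (\<forall>b\<in>B. c b \<in> K) \<and> f i = (\<Sum>b\<in>B. c b * b)"
  shows "\<exists>c. (\<forall>i\<in>I. c i \<in> K) \<and> (\<exists>i\<in>I. c i \<noteq> 0) \<and> (\<Sum>i\<in>I. c i * f i) = 0"
  using assms(7-)
proof (induction B arbitrary: I f rule: finite_induct)
  case empty
  then have "(\<Sum>i\<in>I. 1 * f i) = 0" "I \<noteq> {}"
    by auto
  then show ?case
    using K(2) by (intro exI[of _ "\<lambda>_. 1"]) auto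
next
  case (insert b B)
  have "\<forall>i. \<exists>c. i \<in> I \<longrightarrow> (\<forall>b\<in>insert b B. c b \<in> K) \<and> f i = (\<Sum>b\<in>insert b B. c b * b)"
    using insert.prems(3) by blast
  then obtain a where a: "\<And>i x. i \<in> I \<Longrightarrow> x \<in> insert b B \<Longrightarrow> a i x \<in> K"
    and f: "\<And>i. i \<in> I \<Longrightarrow> f i = a i b * b + (\<Sum>x\<in>B. a i x * x)"
    unfolding choice_iff using insert.hyps by auto
  show ?case
  proof (cases "\<exists>i\<in>I. a i b \<noteq> 0")
    case False
    show ?thesis
    proof (rule insert.IH)
      show "\<exists>c. (\<forall>b\<in>B. c b \<in> K) \<and> f i = (\<Sum>b\<in>B. c b * b)" if "i \<in> I" for i
        using a[OF that] f[OF that] that False by (intro exI[of _ "a i"]) auto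
    qed (use insert in auto)
  next
    case True
    then obtain k where k: "k \<in> I" "a k b \<noteq> 0"
      by blast
    define r where "r i = a i b * inverse (a k b)" for i
    have r: "r i \<in> K" if "i \<in> I" for i
      using a[of i b] a[of k b] that k K by (simp add: r_def)
    define g where "g i = f i - r i * f k" for i
    have "\<exists>c. (\<forall>i\<in>I - {k}. c i \<in> K) \<and> (\<exists>i\<in>I - {k}. c i \<noteq> 0) \<and> (\<Sum>i\<in>I - {k}. c i * g i) = 0"
    proof (rule insert.IH)
      show "\<exists>c. (\<forall>b\<in>B. c b \<in> K) \<and> g i = (\<Sum>b\<in>B. c b * b)" if i: "i \<in> I - {k}" for i
      proof (intro exI[of _ "\<lambda>x. a i x + - (r i * a k x)"] conjI ballI)
        show "a i x + - (r i * a k x) \<in> K" if "x \<in> B" for x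
          using a[of i x] a[of k x] r[of i] that i k(1) by (intro K) simp_all
        have "r i * a k b = a i b"
          using k by (simp add: r_def)
        moreover have "g i = (a i b - r i * a k b) * b + ((\<Sum>x\<in>B. a i x * x) - r i * (\<Sum>x\<in>B. a k x * x))"
          using i k(1) by (simp only: g_def f Diff_iff) (simp only: distrib_left left_diff_distrib mult.assoc add_diff_add)
        moreover have "r i * (\<Sum>x\<in>B. a k x * x) = (\<Sum>x\<in>B. r i * a k x * x)"
          by (simp add: sum_distrib_left mult.assoc)
        ultimately show "g i = (\<Sum>x\<in>B. (a i x + - (r i * a k x)) * x)"
          by (simp add: left_diff_distrib sum_subtractf)
      qed
    qed (use insert k in auto)
    then obtain c where c: "\<And>i. i \<in> I - {k} \<Longrightarrow> c i \<in> K" "\<exists>i\<in>I - {k}. c i \<noteq> 0" "(\<Sum>i\<in>I - {k}. c i * g i) = 0"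
      by blast
    \<comment> \<open>The coefficient at the pivot \<open>k\<close> absorbs the multiples of
      \<open>f k\<close> that were subtracted in \<open>g\<close>.\<close>
    define d where "d = c(k := - (\<Sum>i\<in>I - {k}. c i * r i))"
    have sum_K: "(\<Sum>i\<in>J. h i) \<in> K" if "\<And>i. i \<in> J \<Longrightarrow> h i \<in> K" for h :: "'i \<Rightarrow> 'a" and J
      using that by (induction J rule: infinite_finite_induct) (use K in auto)
    have "- (\<Sum>i\<in>I - {k}. c i * r i) \<in> K"
      using c(1) r by (intro K(5) sum_K K(4)) auto
    then have "d i \<in> K" if "i \<in> I" for i
      using that c(1) by (simp add: d_def)
    moreover have "\<exists>i\<in>I. d i \<noteq> 0"
      using c(2) by (auto simp: d_def)
    moreover have "(\<Sum>i\<in>I. d i * f i) = d k * f k + (\<Sum>i\<in>I - {k}. c i * f i)"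
      using k(1) \<open>finite I\<close> by (simp add: sum.remove[of I k] d_def)
    then have "(\<Sum>i\<in>I. d i * f i) = (\<Sum>i\<in>I - {k}. c i * g i)"
      by (simp add: d_def g_def right_diff_distrib sum_subtractf sum_distrib_right mult.assoc)
    ultimately show ?thesis
      using c(3) by auto
  qed
qed

text \<open>A single exponent \<open>N\<close> makes \<open>|y|^N\<close> a power of
  \<open>p\<close> for every nonzero \<open>y\<close>. Among the values below 1 the largest is then
  the one with the least \<open>m\<close> in \<open>|y|^N = p^(-m)\<close>.\<close>

lemma (in nonarch_absv) exists_uniformizer:
  fixes B :: "'a set"
  assumes p: "prime p" "absv (of_nat p :: 'a) = 1 / real p" and B: "finite B"
    and span: "\<And>x :: 'a. \<exists>c. (\<forall>b\<in>B. c b \<in> closure \<rat>) \<and> x = (\<Sum>b\<in>B. c b * b)"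
  obtains w :: 'a where "w \<noteq> 0" "absv w < 1" "\<forall>x :: 'a. absv x < 1 \<longrightarrow> absv x \<le> absv w"
proof -
  have p_gt: "1 < real p"
    using prime_gt_1_nat[OF p(1)] by simp
  have closure_val: "\<exists>k. absv x = real p powi k" if "x \<in> closure \<rat>" "x \<noteq> 0" for x :: 'a
    using absv_closure_Rats[OF that] absv_Rats[OF p] by metis
  \<comment> \<open>The factorial is divisible by every difference \<open>j - i\<close> of two
    distinct exponents between 0 and \<open>card B\<close>.\<close>
  define N where "N = (fact (card B) :: nat)"
  have "N > 0"
    by (simp add: N_def)
  text \<open>By linear dependence of \<open>1, y, y\<^sup>2, \<dots>\<close>, two terms of a relation have the same absolute
    value, so a power of \<open>\<bar>y\<bar>\<close> of bounded exponent is a power of \<open>p\<close>.\<close>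
  have val: "\<exists>k. absv y ^ N = real p powi k" if "y \<noteq> 0" for y :: 'a
  proof -
    have Rats: "\<rat> \<subseteq> closure (\<rat> :: 'a set)"
      by (rule closure_subset)
    have "(-1 :: 'a) \<in> \<rat>"
      by simp
    then have minus: "- x \<in> closure \<rat>" if "x \<in> closure \<rat>" for x :: 'a
      using closure_Rats_mult[OF subsetD[OF Rats] that] by (metis mult_minus1)
    have "\<exists>c. (\<forall>i\<in>{..card B}. c i \<in> closure \<rat>) \<and> (\<exists>i\<in>{..card B}. c i \<noteq> 0) \<and>
        (\<Sum>i\<in>{..card B}. c i * y ^ i) = 0"
    proof (rule linear_dependence[of "closure \<rat>" B])
      show "\<exists>c. (\<forall>b\<in>B. c b \<in> closure \<rat>) \<and> y ^ i = (\<Sum>b\<in>B. c b * b)" for i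
        by (rule span)
      show "0 \<in> closure (\<rat> :: 'a set)" "1 \<in> closure (\<rat> :: 'a set)"
        using Rats by auto
    qed (simp_all add: B closure_Rats_add closure_Rats_mult closure_Rats_inverse minus)
    then obtain c where c: "\<And>i. i \<le> card B \<Longrightarrow> c i \<in> closure \<rat>" "\<exists>i\<in>{..card B}. c i \<noteq> 0"
        "(\<Sum>i\<in>{..card B}. c i * y ^ i) = 0"
      by auto
    have "\<exists>i\<in>{..card B}. c i * y ^ i \<noteq> 0"
      using c(2) that by simp
    then obtain i j where ij: "i \<in> {..card B}" "j \<in> {..card B}" "i \<noteq> j" "c i * y ^ i \<noteq> 0"
        "absv (c i * y ^ i) = absv (c j * y ^ j)"
      by (rule equal_terms_of_zero_sum[OF finite_atMost c(3)])
    then have "c j * y ^ j \<noteq> 0"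
      using absv_eq_0 by metis
    with ij have "\<exists>i j. i < j \<and> j \<le> card B \<and> c i \<noteq> 0 \<and> c j \<noteq> 0 \<and> absv (c i * y ^ i) = absv (c j * y ^ j)"
      by (metis atMost_iff linorder_neqE_nat mult_zero_left)
    then obtain i j where ij: "i < j" "j \<le> card B" "c i \<noteq> 0" "c j \<noteq> 0"
        "absv (c i * y ^ i) = absv (c j * y ^ j)"
      by blast
    obtain k l where kl: "absv (c i) = real p powi k" "absv (c j) = real p powi l"
      using closure_val c(1)[of i] c(1)[of j] ij by (metis less_imp_le order_trans)
    have "absv y ^ j = absv y ^ i * absv y ^ (j - i)"
      using ij(1) by (simp flip: power_add)
    then have "real p powi k = real p powi l * absv y ^ (j - i)"
      using ij(5) that by (simp add: absv_mult absv_power kl)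
    then have "absv y ^ (j - i) = real p powi (k - l)"
      using p_gt by (simp add: power_int_diff field_simps)
    moreover have "j - i dvd N"
      unfolding N_def using ij by (intro dvd_fact) auto
    then obtain m where "N = (j - i) * m"
      by blast
    ultimately have "absv y ^ N = (real p powi (k - l)) ^ m"
      by (simp add: power_mult)
    then have "absv y ^ N = real p powi ((k - l) * int m)"
      by (simp add: power_int_mult)
    then show ?thesis
      by blast
  qed
  define P where "P m \<longleftrightarrow> (\<exists>y :: 'a. y \<noteq> 0 \<and> absv y < 1 \<and> absv y ^ N = real p powi (- int m))" for m
  have P_val: "\<exists>m. absv y ^ N = real p powi (- int m)" if y: "y \<noteq> 0" "absv y < 1" for y :: 'a
  proof -
    obtain k where k: "absv y ^ N = real p powi k"
      using val[OF y(1)] by blast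
    have "absv y ^ N < 1"
      using y(2) \<open>N > 0\<close> by (simp add: power_less_one_iff)
    then have "k < 0"
      unfolding k using p_gt by (meson not_less one_le_power_int order_less_imp_le)
    then have "k = - int (nat (- k))"
      by simp
    then show ?thesis
      using k by metis
  qed
  \<comment> \<open>The element \<open>p\<close> itself shows that some \<open>m\<close> satisfies
    \<open>P\<close>.\<close>
  have "(of_nat p :: 'a) \<noteq> 0" "absv (of_nat p :: 'a) < 1"
    using p p_gt by auto
  then have "\<exists>m. P m"
    using P_val unfolding P_def by blast
  then have "P (LEAST m. P m)"
    by (rule LeastI_ex)
  then obtain w :: 'a where w: "w \<noteq> 0" "absv w < 1" "absv w ^ N = real p powi (- int (LEAST m. P m))"
    unfolding P_def by blast
  show ?thesis
  proof (rule that[OF w(1,2)], intro allI impI)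
    fix x :: 'a assume x: "absv x < 1"
    show "absv x \<le> absv w"
    proof (cases "x = 0")
      case False
      then obtain m where m: "absv x ^ N = real p powi (- int m)"
        using P_val x by blast
      then have "(LEAST m. P m) \<le> m"
        using False x by (intro Least_le) (auto simp: P_def)
      then have "absv x ^ N \<le> absv w ^ N"
        unfolding m w(3) using p_gt by (intro power_int_increasing) auto
      then show ?thesis
        using \<open>N > 0\<close> by (simp add: power_mono_iff)
    qed simp
  qed
qed

section \<open>The symplectic form\<close>

text \<open>The alternating form with Gram matrix \<open>Jmat\<close>, written out in
  coordinates.\<close>

definition form :: "'a::field^4 \<Rightarrow> 'a^4 \<Rightarrow> 'a" where
  "form x y = x $ 1 * y $ 4 + x $ 2 * y $ 3 - x $ 3 * y $ 2 - x $ 4 * y $ 1"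

lemma form_add_left: "form (x + y) z = form x z + form y z"
  by (simp add: form_def algebra_simps)

lemma form_add_right: "form z (x + y) = form z x + form z y"
  by (simp add: form_def algebra_simps)

lemma form_diff_left: "form (x - y) z = form x z - form y z"
  by (simp add: form_def algebra_simps)

lemma form_diff_right: "form z (x - y) = form z x - form z y"
  by (simp add: form_def algebra_simps)

lemma form_scale_left: "form (c *s x) z = c * form x z"
  by (simp add: form_def algebra_simps)

lemma form_scale_right: "form z (c *s x) = c * form z x"
  by (simp add: form_def algebra_simps)

lemma form_self [simp]: "form x x = 0"
  by (simp add: form_def algebra_simps)

lemma form_swap: "form y x = - form x y"
  by (simp add: form_def algebra_simps)

lemmas form_linear = form_add_left form_add_right form_diff_left form_diff_right
  form_scale_left form_scale_right

lemma vector_scale_linear: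
  "A *v (c *s x) = c *s (A *v x)" for A :: "'a::field^'n^'m"
  by (simp add: vec_eq_iff matrix_vector_mult_def sum_distrib_left algebra_simps)

lemma form_eq_sum: "form x y = (\<Sum>i\<in>UNIV. x $ i * (Jmat *v y) $ i)"
  by (simp add: form_def Jmat_def matrix_vector_mult_def sum_4)

lemma sum_transpose:
  fixes A :: "'a::comm_semiring_1^'n^'m"
  shows "(\<Sum>i\<in>UNIV. (A *v x) $ i * z $ i) = (\<Sum>j\<in>UNIV. x $ j * (transpose A *v z) $ j)"
proof -
  have "(\<Sum>i\<in>UNIV. (A *v x) $ i * z $ i) = (\<Sum>i\<in>UNIV. \<Sum>j\<in>UNIV. A $ i $ j * x $ j * z $ i)"
    by (simp add: matrix_vector_mult_def sum_distrib_right)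
  also have "\<dots> = (\<Sum>j\<in>UNIV. \<Sum>i\<in>UNIV. A $ i $ j * x $ j * z $ i)"
    by (rule sum.swap)
  also have "\<dots> = (\<Sum>j\<in>UNIV. x $ j * (transpose A *v z) $ j)"
    by (simp add: matrix_vector_mult_def transpose_def sum_distrib_left mult_ac)
  finally show ?thesis .
qed

text \<open>Unit vectors on the left isolate the coordinates of \<open>M *v y\<close>.\<close>

lemma bilinear_matrix_eqI:
  fixes M N :: "'a::comm_semiring_1^'n^'m"
  assumes "\<And>x y. (\<Sum>i\<in>UNIV. x $ i * (M *v y) $ i) = (\<Sum>i\<in>UNIV. x $ i * (N *v y) $ i)"
  shows "M = N"
proof -
  have "(M *v y) $ i = (N *v y) $ i" for y i
    using assms[of "axis i 1" y] by (simp add: axis_def if_distrib[of "\<lambda>c. c * _"] cong: if_cong)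
  then show ?thesis
    by (simp add: matrix_eq vec_eq_iff)
qed

text \<open>Comparing the bilinear forms of the two matrices replaces the matrix identity by one
  about values of \<open>form\<close>, the shape in which membership in \<open>GSp4\<close> is used
  below.\<close>

lemma similitude_iff:
  fixes g :: "'a::field^4^4"
  shows "transpose g ** Jmat ** g = mat m ** Jmat \<longleftrightarrow> (\<forall>x y. form (g *v x) (g *v y) = m * form x y)"
proof -
  have 1: "form (g *v x) (g *v y) = (\<Sum>i\<in>UNIV. x $ i * ((transpose g ** Jmat ** g) *v y) $ i)" for x y
    unfolding form_eq_sum sum_transpose by (simp only: matrix_vector_mul_assoc matrix_mul_assoc)
  have "(mat m *v z) $ i = m * z $ i" for z :: "'a^4" and i
    by (simp add: matrix_vector_mult_def mat_def if_distrib[of "\<lambda>c. c * _"] cong: if_cong)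
  then have 2: "m * form x y = (\<Sum>i\<in>UNIV. x $ i * ((mat m ** Jmat) *v y) $ i)" for x y
    unfolding form_eq_sum sum_distrib_left
    by (simp add: matrix_vector_mul_assoc[symmetric] mult_ac)
  show ?thesis
    unfolding 1 2 by (auto intro: bilinear_matrix_eqI)
qed

lemma form_axis_2_3 [simp]: "form (axis 2 1) (axis 3 1) = (1 :: 'a::field)"
  by (simp add: form_def axis_def)

text \<open>The second and third unit vectors pair to 1, so evaluating there recovers the factor;
  this uniqueness settles the description operator in \<open>multiplier\<close>.\<close>

lemma multiplier_eqI:
  assumes "\<And>x y. form (g *v x) (g *v y) = m * form x y"
  shows "multiplier g = m"
  unfolding multiplier_def similitude_iff
proof (rule the_equality)
  show "m' = m" if "\<forall>x y. form (g *v x) (g *v y) = m' * form x y" for m'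
    using that[rule_format, of "axis 2 1" "axis 3 1"] assms[of "axis 2 1" "axis 3 1"] by simp
qed (use assms in auto)

lemma GSp4_iff:
  "g \<in> carrier GSp4 \<longleftrightarrow> invertible g \<and> (\<forall>x y. form (g *v x) (g *v y) = multiplier g * form x y)"
proof -
  have "(\<exists>m. \<forall>x y. form (g *v x) (g *v y) = m * form x y) \<longleftrightarrow>
        (\<forall>x y. form (g *v x) (g *v y) = multiplier g * form x y)"
    using multiplier_eqI by metis
  then show ?thesis
    by (simp add: GSp4_def similitude_iff)
qed

lemma GSp4I:
  assumes "g ** h = mat 1" "\<And>x y. form (g *v x) (g *v y) = m * form x y"
  shows "g \<in> carrier GSp4"
  using assms multiplier_eqI[of g m] GSp4_iff invertible_right_inverse by metis

lemma form_GSp4: "g \<in> carrier GSp4 \<Longrightarrow> form (g *v x) (g *v y) = multiplier g * form x y"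
  by (simp add: GSp4_iff)

lemma mult_GSp4 [simp]: "g \<otimes>\<^bsub>GSp4\<^esub> h = g ** h"
  by (simp add: GSp4_def)

lemma one_GSp4 [simp]: "\<one>\<^bsub>GSp4\<^esub> = mat 1"
  by (simp add: GSp4_def)

text \<open>Since \<open>g\<close> is onto, a factor 0 would make \<open>form\<close> vanish
  identically.\<close>

lemma multiplier_nonzero:
  assumes "g \<in> carrier GSp4" shows "multiplier g \<noteq> 0"
proof
  assume 0: "multiplier g = 0"
  obtain h where "g ** h = mat 1"
    using assms by (auto simp: GSp4_iff invertible_def)
  then have "g *v (h *v x) = x" for x
    by (simp add: matrix_vector_mul_assoc)
  then have "form x y = 0" for x y :: "'a^4"
    using form_GSp4[OF assms, of "h *v x" "h *v y"] 0 by simp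
  then show False
    using form_axis_2_3[where 'a='a] by simp
qed

section \<open>The group structure and the multiplier as a character\<close>

lemma group_GSp4: "Group.group (GSp4 :: ('a::field^4^4) monoid)"
proof (rule groupI; simp?)
  show "x ** y \<in> carrier GSp4"
    if x: "x \<in> carrier GSp4" and y: "y \<in> carrier GSp4" for x y :: "'a^4^4"
  proof -
    obtain y' where "y ** y' = mat 1"
      using y unfolding GSp4_iff invertible_def by blast
    moreover obtain x' where "x ** x' = mat 1"
      using x unfolding GSp4_iff invertible_def by blast
    ultimately have "x ** y ** (y' ** x') = mat 1"
      by (metis matrix_mul_assoc matrix_mul_rid)
    then show ?thesis
      by (rule GSp4I[where m = "multiplier x * multiplier y"])
         (simp add: matrix_vector_mul_assoc[symmetric] form_GSp4 x y)
  qed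
  show "(mat 1 :: 'a^4^4) \<in> carrier GSp4"
    by (rule GSp4I[of _ "mat 1" 1]) auto
  show "\<exists>y\<in>carrier GSp4. y ** x = mat 1" if x: "x \<in> carrier GSp4" for x :: "'a^4^4"
  proof -
    obtain y where y: "x ** y = mat 1" "y ** x = mat 1"
      using x by (auto simp: GSp4_iff invertible_def)
    have "form (y *v u) (y *v v) = inverse (multiplier x) * form u v" for u v
      using form_GSp4[OF x, of "y *v u" "y *v v"] multiplier_nonzero[OF x] y
      by (simp add: matrix_vector_mul_assoc field_simps)
    then show ?thesis
      using y GSp4I by blast
  qed
  show "x ** y ** z = x ** (y ** z)" for x y z :: "'a^4^4"
    by (simp add: matrix_mul_assoc)
qed

interpretation GSp4: Group.group GSp4
  by (rule group_GSp4)

lemma mult_in_GSp4: "g \<in> carrier GSp4 \<Longrightarrow> h \<in> carrier GSp4 \<Longrightarrow> g ** h \<in> carrier GSp4"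
  using GSp4.m_closed[of g h] by simp

lemma inv_GSp4:
  assumes "g \<in> carrier GSp4"
  shows "inv\<^bsub>GSp4\<^esub> g ** g = mat 1" "g ** inv\<^bsub>GSp4\<^esub> g = mat 1"
  using GSp4.l_inv[OF assms] GSp4.r_inv[OF assms] by simp_all

lemma inv_GSp4_cancel:
  assumes "g \<in> carrier GSp4"
  shows "inv\<^bsub>GSp4\<^esub> g *v (g *v x) = x" "g *v (inv\<^bsub>GSp4\<^esub> g *v x) = x"
  by (simp_all add: matrix_vector_mul_assoc inv_GSp4 assms)

lemma multiplier_inv:
  assumes "g \<in> carrier GSp4"
  shows "multiplier (inv\<^bsub>GSp4\<^esub> g) = inverse (multiplier g)"
proof (rule multiplier_eqI)
  show "form (inv\<^bsub>GSp4\<^esub> g *v x) (inv\<^bsub>GSp4\<^esub> g *v y) = inverse (multiplier g) * form x y" for x y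
    using form_GSp4[OF assms, of "inv\<^bsub>GSp4\<^esub> g *v x" "inv\<^bsub>GSp4\<^esub> g *v y"] multiplier_nonzero[OF assms]
    by (simp add: inv_GSp4_cancel[OF assms] field_simps)
qed

lemma multiplier_mult:
  assumes "g \<in> carrier GSp4" "h \<in> carrier GSp4"
  shows "multiplier (g ** h) = multiplier g * multiplier h"
  by (rule multiplier_eqI) (simp add: matrix_vector_mul_assoc[symmetric] form_GSp4 assms)

section \<open>Symplectic transvections\<close>

definition transvection :: "'a::field \<Rightarrow> 'a^4 \<Rightarrow> 'a^4^4" where
  "transvection c v = (\<chi> i j. (if i = j then 1 else 0) + c * v $ i * form (axis j 1) v)"

lemma transvection_apply: "transvection c v *v x = x + (c * form x v) *s v"
  unfolding vec_eq_iff forall_4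
  by (simp add: transvection_def matrix_vector_mult_def sum_4 form_def axis_def algebra_simps)

lemma transvection_mult:
  "transvection c v ** transvection d v = transvection (c + d) v"
  unfolding matrix_eq
  by (simp add: matrix_vector_mul_assoc[symmetric] transvection_apply form_linear algebra_simps)

lemma transvection_0 [simp]: "transvection 0 v = mat 1"
  by (simp add: matrix_eq transvection_apply)

lemma form_transvection:
  "form (transvection c v *v x) (transvection c v *v y) = form x y"
  by (simp add: transvection_apply form_linear form_swap[of y v] algebra_simps)

lemma transvection_in_GSp4 [simp]: "transvection c v \<in> carrier GSp4"
  by (rule GSp4I[of _ "transvection (-c) v" 1]) (simp_all add: transvection_mult form_transvection)

lemma multiplier_transvection [simp]: "multiplier (transvection c v) = 1"
  by (rule multiplier_eqI) (simp add: form_transvection)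

text \<open>Conjugation by \<open>g\<close> turns coefficient \<open>d\<close> along
  \<open>e\<close> into \<open>d / \<mu>(g)\<close> along \<open>g *v e\<close>, because
  \<open>g\<close> scales the form by \<open>\<mu>(g)\<close>. Passing from the vector
  \<open>a *s v\<close> to \<open>v\<close> multiplies the coefficient by
  \<open>a^2\<close>.\<close>

lemma transvection_conj:
  assumes "g \<in> carrier GSp4" and "g *v e = a *s v" and "a \<noteq> 0"
  shows "transvection c v ** g = g ** transvection (c * multiplier g / a\<^sup>2) e"
proof -
  have "v = inverse a *s (g *v e)"
    using assms by simp
  then show ?thesis
    unfolding matrix_eq
    by (simp add: matrix_vector_mul_assoc[symmetric] transvection_apply form_linear form_GSp4 assms(1)
        matrix_vector_right_distrib vector_scale_linear power2_eq_square divide_inverse mult_ac)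
qed

section \<open>Lattices over a discretely valued field\<close>

text \<open>Discreteness is expressed by an element \<open>w\<close> of largest absolute value below
  1; every nonzero value is then a power of \<open>absv w\<close>, as \<open>absv_eq_w_powi\<close>
  shows.\<close>

locale discrete_absv = nonarch_absv "TYPE('a)" for w :: "'a::{field_char_0, metric_space}" +
  assumes w_nonzero: "w \<noteq> 0"
    and absv_w: "absv w < 1"
    and absv_le_w: "absv (x :: 'a) < 1 \<Longrightarrow> absv x \<le> absv w"
begin

lemma absv_w_pos: "0 < absv w"
  using w_nonzero absv_nonneg[of w] by (simp add: less_le)

lemma mem_int_ring: "(x :: 'a) \<in> int_ring \<longleftrightarrow> absv x \<le> 1"
  by (simp add: int_ring_def)

text \<open>A generator of the maximal ideal must reach the largest value below 1, since integral
  multiples of it are no larger; conversely, division by an element of that value is integral on the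
  ideal.\<close>

lemma uniformizer_iff: "uniformizer u \<longleftrightarrow> absv (u :: 'a) = absv w"
proof
  assume u: "uniformizer u"
  then have max: "max_ideal = (*) u ` int_ring"
    by (simp add: uniformizer_def)
  have "w \<in> max_ideal"
    using absv_w by (simp add: max_ideal_def)
  then obtain y where "w = u * y" "y \<in> int_ring"
    unfolding max by blast
  then have "absv w \<le> absv u"
    by (simp add: absv_mult mult_left_le mem_int_ring)
  moreover have "u * 1 \<in> max_ideal"
    unfolding max by (rule imageI) (simp add: mem_int_ring)
  ultimately show "absv u = absv w"
    using absv_le_w by (simp add: max_ideal_def antisym)
next
  assume u: "absv u = absv w"
  then have "u \<noteq> 0"
    using absv_w_pos by auto
  have "x \<in> (*) u ` int_ring" if "absv x < 1" for x
  proof (rule image_eqI)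
    show "x = u * (x / u)"
      using \<open>u \<noteq> 0\<close> by simp
    have "absv x \<le> absv u"
      using absv_le_w[OF that] u by simp
    then show "x / u \<in> int_ring"
      using absv_w_pos u by (simp add: mem_int_ring absv_divide)
  qed
  moreover have "absv (u * y) < 1" if "absv y \<le> 1" for y
  proof -
    have "absv (u * y) \<le> absv w"
      using that by (simp add: absv_mult u mult_left_le)
    then show ?thesis
      using absv_w by simp
  qed
  ultimately show "uniformizer u"
    using \<open>u \<noteq> 0\<close> by (auto simp: uniformizer_def max_ideal_def mem_int_ring)
qed

text \<open>All uniformizers have the value of \<open>w\<close>, so the ideals are balls and
  membership becomes an inequality between values.\<close>

lemma frac_ideal_iff: "(x :: 'a) \<in> frac_ideal k \<longleftrightarrow> absv x \<le> absv w powi k"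
proof
  assume "x \<in> frac_ideal k"
  then show "absv x \<le> absv w powi k"
    by (auto simp: frac_ideal_def uniformizer_iff mem_int_ring absv_mult absv_powi mult_left_le)
next
  assume le: "absv x \<le> absv w powi k"
  have "x = w powi k * (x / w powi k)"
    using w_nonzero by simp
  moreover have "x / w powi k \<in> int_ring"
    using le absv_w_pos by (simp add: mem_int_ring absv_divide absv_powi)
  ultimately show "x \<in> frac_ideal k"
    unfolding frac_ideal_def using uniformizer_iff by blast
qed

section \<open>Arithmetic of fractional ideals\<close>

lemma frac_ideal_0: "frac_ideal 0 = (int_ring :: 'a set)"
  by (auto simp: frac_ideal_iff mem_int_ring)

lemma zero_in_frac_ideal [simp]: "(0 :: 'a) \<in> frac_ideal k"
  using absv_w_pos by (simp add: frac_ideal_iff absv_def)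

lemma w_powi_in_frac_ideal [simp]: "w powi k \<in> frac_ideal k"
  by (simp add: frac_ideal_iff absv_powi)

lemma w_in_frac_ideal [simp]: "w \<in> frac_ideal 1"
  using w_powi_in_frac_ideal[of 1] by simp

lemma one_in_frac_ideal [simp]: "(1 :: 'a) \<in> frac_ideal 0"
  by (simp add: frac_ideal_iff)

lemma frac_ideal_add: "x \<in> frac_ideal k \<Longrightarrow> y \<in> frac_ideal k \<Longrightarrow> (x + y :: 'a) \<in> frac_ideal k"
  using absv_add[of x y] by (simp add: frac_ideal_iff)

lemma frac_ideal_minus [simp]: "(- x :: 'a) \<in> frac_ideal k \<longleftrightarrow> x \<in> frac_ideal k"
  by (simp add: frac_ideal_iff)

lemma frac_ideal_diff: "x \<in> frac_ideal k \<Longrightarrow> y \<in> frac_ideal k \<Longrightarrow> (x - y :: 'a) \<in> frac_ideal k"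
  using frac_ideal_add[of x k "- y"] by simp

lemma frac_ideal_sum: "(\<And>i. i \<in> I \<Longrightarrow> f i \<in> frac_ideal k) \<Longrightarrow> (\<Sum>i\<in>I. f i :: 'a) \<in> frac_ideal k"
  by (induction I rule: infinite_finite_induct) (auto intro: frac_ideal_add)

lemma absv_w_powi_le_iff: "absv w powi k \<le> absv w powi l \<longleftrightarrow> l \<le> k"
  using absv_w absv_w_pos
  by (metis linorder_not_le power_int_strict_decreasing power_int_decreasing order_less_imp_le less_le)

lemma frac_ideal_mono: "l \<le> k \<Longrightarrow> frac_ideal k \<subseteq> (frac_ideal l :: 'a set)"
  using absv_w_powi_le_iff order_trans by (fastforce simp: frac_ideal_iff)

lemma frac_ideal_mult:
  assumes "x \<in> frac_ideal k" "y \<in> frac_ideal l" "m \<le> k + l"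
  shows "(x * y :: 'a) \<in> frac_ideal m"
proof -
  have "absv (x * y) \<le> absv w powi k * absv w powi l"
    unfolding absv_mult using assms absv_w_pos by (intro mult_mono) (auto simp: frac_ideal_iff)
  then have "x * y \<in> frac_ideal (k + l)"
    using w_nonzero by (simp add: frac_ideal_iff power_int_add)
  then show ?thesis
    using frac_ideal_mono[OF assms(3)] by blast
qed

text \<open>A value strictly between \<open>|w|^(k+1)\<close> and \<open>|w|^k\<close> would, after
  division by \<open>w^k\<close>, lie strictly between \<open>|w|\<close> and 1.\<close>

lemma absv_eq_w_powi:
  assumes "(x :: 'a) \<noteq> 0"
  obtains k where "absv x = absv w powi k"
proof -
  let ?t = "absv w"
  \<comment> \<open>The base is below 1, so its powers decrease and the floor gives
    \<open>|w|^(k+1) < |x| \<le> |w|^k\<close>.\<close>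
  define k where "k = \<lfloor>log ?t (absv x)\<rfloor>"
  have pos: "0 < absv x"
    using assms absv_nonneg[of x] by (simp add: less_le)
  have powr: "?t powr real_of_int m = ?t powi m" for m
    using w_nonzero by (simp add: powr_real_of_int')
  have log: "?t powr log ?t (absv x) = absv x"
    using absv_w absv_w_pos pos by simp
  have "?t powr log ?t (absv x) \<le> ?t powr real_of_int k"
    using absv_w absv_w_pos by (intro powr_mono') (simp_all add: k_def)
  then have le: "absv x \<le> ?t powi k"
    by (simp only: powr log)
  have "?t powr real_of_int (k + 1) < ?t powr log ?t (absv x)"
    using absv_w absv_w_pos by (intro powr_less_mono') (simp_all add: k_def)
  then have less: "?t powi (k + 1) < absv x"
    by (simp only: powr log)
  have "\<not> absv (x / w powi k) < 1"
  proof
    assume "absv (x / w powi k) < 1"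
    then have "absv (x / w powi k) \<le> ?t"
      by (rule absv_le_w)
    then have "absv x \<le> ?t * ?t powi k"
      using absv_w_pos by (simp add: absv_divide absv_powi pos_divide_le_eq)
    then show False
      using less w_nonzero by (simp add: power_int_add mult_ac)
  qed
  then have "?t powi k \<le> absv x"
    using absv_w_pos by (simp add: absv_divide absv_powi not_less pos_le_divide_eq)
  then have "absv x = ?t powi k"
    using le by simp
  then show ?thesis
    by (rule that)
qed

text \<open>Outside \<open>\<pp>^l\<close> the valuation of \<open>y\<close> is at most
  \<open>l - 1\<close>; this accounts for the extra 1.\<close>

lemma frac_ideal_divide:
  assumes "x \<in> frac_ideal k" "y \<notin> frac_ideal l" "m \<le> k - l + 1"
  shows "(x / y :: 'a) \<in> frac_ideal m"
proof -
  have "y \<noteq> 0"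
    using assms(2) by auto
  then obtain j where j: "absv y = absv w powi j"
    by (rule absv_eq_w_powi)
  then have "j < l"
    using assms(2) absv_w_powi_le_iff by (simp add: frac_ideal_iff)
  have "inverse y \<in> frac_ideal (- j)"
    by (simp add: frac_ideal_iff absv_inverse j power_int_minus)
  then show ?thesis
    unfolding divide_inverse using \<open>j < l\<close> assms(1,3) by (intro frac_ideal_mult[of x k _ "- j"]) simp_all
qed

lemma int_units_iff: "(x :: 'a) \<in> int_units \<longleftrightarrow> absv x = 1"
proof
  assume x: "x \<in> int_units"
  then have "0 < absv x"
    using absv_nonneg[of x] by (simp add: int_units_def less_le)
  then show "absv x = 1"
    using x by (auto simp: int_units_def mem_int_ring absv_inverse inverse_le_1_iff)
next
  assume "absv x = 1"
  moreover from this have "x \<noteq> 0"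
    by auto
  ultimately show "x \<in> int_units"
    by (simp add: int_units_def mem_int_ring absv_inverse)
qed

section \<open>Lattices of column vectors and the matrices between them\<close>

lemma int_submodule_coord_lattice: "int_submodule (coord_lattice e :: ('a^4) set)"
proof -
  have "c * x \<in> frac_ideal k" if "c \<in> int_ring" "x \<in> frac_ideal k" for c x :: 'a and k
    using frac_ideal_mult[of c 0 x k k] that by (simp add: frac_ideal_0)
  then show ?thesis
    by (auto simp: int_submodule_def coord_lattice_def frac_ideal_add)
qed

end

lemma int_submodule_add: "int_submodule A \<Longrightarrow> x \<in> A \<Longrightarrow> y \<in> A \<Longrightarrow> x + y \<in> A"
  by (simp add: int_submodule_def)

lemma int_submodule_scale: "int_submodule A \<Longrightarrow> c \<in> int_ring \<Longrightarrow> x \<in> A \<Longrightarrow> c *s x \<in> A"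
  by (simp add: int_submodule_def)

context discrete_absv
begin

lemma int_submodule_diff: "int_submodule A \<Longrightarrow> x \<in> A \<Longrightarrow> y \<in> A \<Longrightarrow> (x - y :: 'a^4) \<in> A"
  using int_submodule_add[of A x "(-1) *s y"] int_submodule_scale[of A "-1" y]
  by (simp add: mem_int_ring flip: scaleR_minus1_left)

text \<open>There is one inequality for each of the four products in \<open>form\<close>.\<close>

lemma form_in_frac_ideal:
  assumes "x \<in> coord_lattice d" "y \<in> coord_lattice e"
    and "k \<le> d $ 1 + e $ 4" "k \<le> d $ 2 + e $ 3" "k \<le> d $ 3 + e $ 2" "k \<le> d $ 4 + e $ 1"
  shows "form x y \<in> (frac_ideal k :: 'a set)"
  unfolding form_def using assms(1,2)
  by (intro frac_ideal_add frac_ideal_diff)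
     (auto simp: coord_lattice_def intro: frac_ideal_mult assms(3-))

text \<open>Necessity is tested on the unit vectors scaled by \<open>w powi d $ j\<close>, which lie
  in the source lattice.\<close>

lemma maps_coord_lattice_iff:
  fixes g :: "'a^4^4"
  shows "(\<forall>x\<in>coord_lattice d. g *v x \<in> coord_lattice e) \<longleftrightarrow> (\<forall>i j. g $ i $ j \<in> frac_ideal (e $ i - d $ j))"
proof (intro iffI allI ballI)
  fix i j
  assume maps: "\<forall>x\<in>coord_lattice d. g *v x \<in> coord_lattice e"
  have "axis j (w powi d $ j) \<in> coord_lattice d"
    by (auto simp: coord_lattice_def axis_def)
  then have "(g *v axis j (w powi d $ j)) $ i \<in> frac_ideal (e $ i)"
    using maps by (auto simp: coord_lattice_def)
  then have "g $ i $ j * w powi d $ j \<in> frac_ideal (e $ i)"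
    by (simp add: matrix_vector_mult_def axis_def if_distrib[of "\<lambda>c. _ * c"] cong: if_cong)
  then have "g $ i $ j * w powi d $ j * w powi (- d $ j) \<in> frac_ideal (e $ i - d $ j)"
    by (rule frac_ideal_mult) auto
  then show "g $ i $ j \<in> frac_ideal (e $ i - d $ j)"
    using w_nonzero by (simp add: power_int_minus mult.assoc)
next
  fix x :: "'a^4"
  assume g: "\<forall>i j. g $ i $ j \<in> frac_ideal (e $ i - d $ j)" and x: "x \<in> coord_lattice d"
  have "g $ i $ j * x $ j \<in> frac_ideal (e $ i)" for i j
  proof (rule frac_ideal_mult)
    show "g $ i $ j \<in> frac_ideal (e $ i - d $ j)" "x $ j \<in> frac_ideal (d $ j)"
      using g x by (simp_all add: coord_lattice_def)
  qed simp
  then show "g *v x \<in> coord_lattice e"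
    by (simp add: coord_lattice_def matrix_vector_mult_def frac_ideal_sum)
qed

lemma frac_ideal_both:
  "x \<in> frac_ideal k \<and> x \<in> frac_ideal l \<longleftrightarrow> (x :: 'a) \<in> frac_ideal (max k l)"
  using frac_ideal_mono[of k l] frac_ideal_mono[of l k] by (auto simp: max_def)

text \<open>Each exponent of the pattern is the larger of the two demanded by stability of
  \<open>L0\<close> and of \<open>L1\<close>. The entry conditions thus become conditions on the
  action on the lattice chain.\<close>

lemma entries_Kpara_iff:
  fixes g :: "'a^4^4"
  shows "g \<in> entries_in (vector [vector [0, 0, 0, -1], vector [1, 0, 0, 0],
                               vector [1, 0, 0, 0], vector [1, 1, 1, 0]]) \<longleftrightarrow>
    (\<forall>x\<in>L0. g *v x \<in> L0) \<and> (\<forall>x\<in>L1. g *v x \<in> L1)"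
  unfolding maps_coord_lattice_iff all_conj_distrib[symmetric] frac_ideal_both
  by (simp add: entries_in_def forall_4)

lemma entries_Kpara_plus_iff:
  fixes g :: "'a^4^4"
  shows "g \<in> entries_in (vector [vector [1, 0, 0, 0], vector [1, 1, 1, 0],
                               vector [1, 1, 1, 0], vector [2, 1, 1, 1]]) \<longleftrightarrow>
    (\<forall>x\<in>L0. g *v x \<in> L1) \<and> (\<forall>x\<in>L1. g *v x \<in> L2)"
  unfolding maps_coord_lattice_iff all_conj_distrib[symmetric] frac_ideal_both
  by (simp add: entries_in_def forall_4)

lemma Kpara_iff:
  "g \<in> (Kpara :: ('a^4^4) set) \<longleftrightarrow> g \<in> carrier GSp4 \<and> absv (multiplier g) = 1 \<and>
     (\<forall>x\<in>L0. g *v x \<in> L0) \<and> (\<forall>x\<in>L1. g *v x \<in> L1)"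
  unfolding Kpara_def Int_iff entries_Kpara_iff GSp4_0_def by (auto simp: int_units_iff)

lemma Kpara_plus_iff:
  "g \<in> (Kpara_plus :: ('a^4^4) set) \<longleftrightarrow> g \<in> carrier GSp4 \<and>
     (\<forall>x\<in>L0. g *v x - x \<in> L1) \<and> (\<forall>x\<in>L1. g *v x - x \<in> L2)"
  unfolding Kpara_plus_def Int_iff mem_Collect_eq entries_Kpara_plus_iff
  by (auto simp: matrix_vector_mult_diff_rdistrib)

lemma lattice_chain:
  "(L1 :: ('a^4) set) \<subseteq> L0" "(L2 :: ('a^4) set) \<subseteq> L1"
  using frac_ideal_mono[of 0 1] frac_ideal_mono[of 1 2]
  by (auto simp: coord_lattice_def forall_4)

end

section \<open>Transvections in the paramodular group\<close>

context discrete_absv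
begin

text \<open>The point is that the multiplier is a unit. It equals the pairing of the images of the
  second and third unit vectors; these move by elements of \<open>L1\<close>, whose pairings with
  \<open>L0\<close> lie in \<open>\<pp>\<close>, so the multiplier is 1 modulo
  \<open>\<pp>\<close>.\<close>

lemma Kpara_plus_subset: "Kpara_plus \<subseteq> (Kpara :: ('a^4^4) set)"
proof
  fix k :: "'a^4^4" assume k: "k \<in> Kpara_plus"
  then have G: "k \<in> carrier GSp4" and k0: "\<And>x. x \<in> L0 \<Longrightarrow> k *v x - x \<in> L1"
    and k1: "\<And>x. x \<in> L1 \<Longrightarrow> k *v x - x \<in> L2"
    by (simp_all add: Kpara_plus_iff)
  define a where "a = (axis 2 1 :: 'a^4)"
  define b where "b = (axis 3 1 :: 'a^4)"
  have ab: "a \<in> L0" "b \<in> L0"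
    by (simp_all add: a_def b_def coord_lattice_def forall_4 axis_def)
  have "multiplier k = form (k *v a) (k *v b)"
    using form_GSp4[OF G, of a b] by (simp add: a_def b_def)
  also have "\<dots> = 1 + (form (k *v a - a) (k *v b) + form a (k *v b - b))"
    using form_axis_2_3[where 'a='a] by (simp add: form_linear a_def b_def del: form_axis_2_3)
  finally have "multiplier k - 1 = form (k *v a - a) (k *v b - b) + form (k *v a - a) b + form a (k *v b - b)"
    by (simp add: form_linear)
  also have "\<dots> \<in> frac_ideal 1"
  proof (intro frac_ideal_add)
    show "form (k *v a - a) (k *v b - b) \<in> frac_ideal 1"
      using k0[OF ab(1)] k0[OF ab(2)] by (rule form_in_frac_ideal) simp_all
    show "form (k *v a - a) b \<in> frac_ideal 1"
      using k0[OF ab(1)] ab(2) by (rule form_in_frac_ideal) simp_all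
    show "form a (k *v b - b) \<in> frac_ideal 1"
      using ab(1) k0[OF ab(2)] by (rule form_in_frac_ideal) simp_all
  qed
  finally have "absv (multiplier k - 1) < 1"
    using absv_w by (simp add: frac_ideal_iff)
  moreover have "absv (multiplier k) \<le> max (absv (multiplier k - 1)) 1"
    using absv_add[of "multiplier k - 1" 1] by simp
  moreover have "1 \<le> max (absv (multiplier k)) (absv (multiplier k - 1))"
    using absv_add[of "multiplier k" "- (multiplier k - 1)"] absv_minus[of "multiplier k - 1"] by simp
  ultimately have "absv (multiplier k) = 1"
    by (simp add: max_def split: if_splits)
  moreover have "k *v x \<in> L0" if "x \<in> L0" for x
    using int_submodule_add[OF int_submodule_coord_lattice that, of "k *v x - x"] k0[OF that] lattice_chain
    by auto
  moreover have "k *v x \<in> L1" if "x \<in> L1" for x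
    using int_submodule_add[OF int_submodule_coord_lattice that, of "k *v x - x"] k1[OF that] lattice_chain
    by auto
  ultimately show "k \<in> Kpara"
    using G by (simp add: Kpara_iff)
qed

text \<open>Pairing with suitable unit vectors or their multiples by \<open>w\<close> isolates the
  coordinates. Together with \<open>L1_dual\<close> this makes the two lattices dual to each other
  for the form with values modulo \<open>\<pp>\<close>.\<close>

lemma L0_dual: "x \<in> L0 \<longleftrightarrow> (\<forall>y\<in>L1. form x y \<in> frac_ideal 1)" for x :: "'a^4"
proof
  assume "x \<in> L0"
  then show "\<forall>y\<in>L1. form x y \<in> frac_ideal 1"
    by (auto intro: form_in_frac_ideal)
next
  assume *: "\<forall>y\<in>L1. form x y \<in> frac_ideal 1"
  have "x $ 4 \<in> frac_ideal 1"
    using *[rule_format, of "axis 1 1"] by (simp add: coord_lattice_def forall_4 axis_def form_def)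
  moreover have "w * x $ i \<in> frac_ideal 1" if "i \<noteq> 4" for i
    using exhaust_4[of i] that *[rule_format, of "axis 4 w"] *[rule_format, of "axis 3 w"]
      *[rule_format, of "axis 2 w"]
    by (auto simp: coord_lattice_def forall_4 axis_def form_def mult.commute)
  then have "x $ i \<in> frac_ideal 0" if "i \<noteq> 4" for i
    using that absv_w_pos by (simp add: frac_ideal_iff absv_mult)
  ultimately show "x \<in> L0"
    by (simp add: coord_lattice_def forall_4)
qed

lemma L1_dual: "x \<in> L1 \<longleftrightarrow> (\<forall>y\<in>L0. form x y \<in> frac_ideal 1)" for x :: "'a^4"
proof
  assume "x \<in> L1"
  then show "\<forall>y\<in>L0. form x y \<in> frac_ideal 1"
    by (auto intro: form_in_frac_ideal)
next
  assume *: "\<forall>y\<in>L0. form x y \<in> frac_ideal 1"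
  have "x $ i \<in> frac_ideal 1" if "i \<noteq> 1" for i
    using exhaust_4[of i] that *[rule_format, of "axis 3 1"] *[rule_format, of "axis 2 1"]
      *[rule_format, of "axis 1 1"]
    by (auto simp: coord_lattice_def forall_4 axis_def form_def)
  moreover have "x $ 1 * w \<in> frac_ideal 1"
    using *[rule_format, of "axis 4 w"] by (simp add: coord_lattice_def forall_4 axis_def form_def)
  then have "x $ 1 \<in> frac_ideal 0"
    using absv_w_pos by (simp add: frac_ideal_iff absv_mult)
  ultimately show "x \<in> L1"
    by (simp add: coord_lattice_def forall_4)
qed

section \<open>The subgroup property of \<open>Kpara\<close> and \<open>Kpara_plus\<close>\<close>

lemma subgroup_Kpara: "subgroup (Kpara :: ('a^4^4) set) GSp4"
proof
  show "Kpara \<subseteq> (carrier GSp4 :: ('a^4^4) set)"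
    by (auto simp: Kpara_iff)
  show "x \<otimes>\<^bsub>GSp4\<^esub> y \<in> Kpara" if "x \<in> Kpara" "y \<in> Kpara" for x y :: "'a^4^4"
    using that by (simp add: Kpara_iff mult_in_GSp4 multiplier_mult absv_mult flip: matrix_vector_mul_assoc)
  show "\<one>\<^bsub>GSp4\<^esub> \<in> (Kpara :: ('a^4^4) set)"
    using GSp4.one_closed[where 'a='a] multiplier_transvection[of 0 "0 :: 'a^4"]
    by (simp add: Kpara_iff)
  show "inv\<^bsub>GSp4\<^esub> g \<in> Kpara" if g: "g \<in> Kpara" for g :: "'a^4^4"
  proof -
    have G: "g \<in> carrier GSp4" and unit: "absv (multiplier g) = 1"
      using g by (simp_all add: Kpara_iff)
    let ?h = "inv\<^bsub>GSp4\<^esub> g"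
    \<comment> \<open>The inverse is the adjoint of \<open>g\<close> up to a unit. By duality,
      stability of \<open>L1\<close> under \<open>g\<close> gives stability of \<open>L0\<close>
      under the inverse, and vice versa.\<close>
    have "form x (g *v y) = multiplier g * form (?h *v x) y" for x y
      using form_GSp4[OF G, of "?h *v x" y] by (simp add: inv_GSp4_cancel[OF G])
    then have adj: "form (?h *v x) y \<in> frac_ideal 1 \<longleftrightarrow> form x (g *v y) \<in> frac_ideal 1" for x y
      by (simp add: frac_ideal_iff absv_mult unit)
    have "?h *v x \<in> L0" if "x \<in> L0" for x
      unfolding L0_dual[of "?h *v x"] adj using that g by (auto simp: L0_dual Kpara_iff)
    moreover have "?h *v x \<in> L1" if "x \<in> L1" for x
      unfolding L1_dual[of "?h *v x"] adj using that g by (auto simp: L1_dual[of x] Kpara_iff)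
    ultimately show ?thesis
      using G unit by (simp add: Kpara_iff multiplier_inv absv_inverse)
  qed
qed


text \<open>If \<open>h'\<close> denotes the inverse of \<open>h\<close>, then
  \<open>k h' - 1 = (k - h) h'\<close>, and \<open>h'\<close> preserves both lattices.\<close>

lemma Kpara_plus_divI:
  assumes k: "k \<in> Kpara" and h: "h \<in> (Kpara :: ('a^4^4) set)"
    and "\<And>x. x \<in> L0 \<Longrightarrow> k *v x - h *v x \<in> L1" "\<And>x. x \<in> L1 \<Longrightarrow> k *v x - h *v x \<in> L2"
  shows "k ** inv\<^bsub>GSp4\<^esub> h \<in> Kpara_plus"
proof -
  have G: "k \<in> carrier GSp4" "h \<in> carrier GSp4"
    using k h by (simp_all add: Kpara_iff)
  have inv: "inv\<^bsub>GSp4\<^esub> h \<in> Kpara"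
    using subgroup.m_inv_closed[OF subgroup_Kpara h] .
  then have "inv\<^bsub>GSp4\<^esub> h \<in> carrier GSp4"
    by (simp add: Kpara_iff)
  then have "k ** inv\<^bsub>GSp4\<^esub> h \<in> carrier GSp4"
    using G by (simp add: mult_in_GSp4)
  moreover have "(k ** inv\<^bsub>GSp4\<^esub> h) *v x - x = k *v (inv\<^bsub>GSp4\<^esub> h *v x) - h *v (inv\<^bsub>GSp4\<^esub> h *v x)" for x
    by (simp add: inv_GSp4_cancel G flip: matrix_vector_mul_assoc)
  ultimately show ?thesis
    using assms(3,4) inv by (simp add: Kpara_plus_iff Kpara_iff)
qed

lemma subgroup_Kpara_plus: "subgroup (Kpara_plus :: ('a^4^4) set) GSp4"
proof (rule GSp4.subgroupI)
  show "Kpara_plus \<subseteq> (carrier GSp4 :: ('a^4^4) set)"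
    by (auto simp: Kpara_plus_iff)
  have one: "mat 1 \<in> (Kpara :: ('a^4^4) set)" "mat 1 \<in> (Kpara_plus :: ('a^4^4) set)"
    using subgroup.one_closed[OF subgroup_Kpara] GSp4.one_closed[where 'a='a]
    by (simp_all add: Kpara_plus_iff coord_lattice_def)
  then show "(Kpara_plus :: ('a^4^4) set) \<noteq> {}"
    by auto
  have neg: "x - y \<in> coord_lattice e \<longleftrightarrow> y - x \<in> coord_lattice e" for x y :: "'a^4" and e
    unfolding coord_lattice_def using frac_ideal_minus[of "(x - y) $ i" for i] by simp
  show "inv\<^bsub>GSp4\<^esub> k \<in> Kpara_plus" if "k \<in> Kpara_plus" for k :: "'a^4^4"
  proof -
    have "mat 1 ** inv\<^bsub>GSp4\<^esub> k \<in> Kpara_plus"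
      using that Kpara_plus_subset
      by (intro Kpara_plus_divI one(1)) (auto simp: Kpara_plus_iff neg[of _ "k *v _"])
    then show ?thesis
      by simp
  qed
  show "k \<otimes>\<^bsub>GSp4\<^esub> h \<in> Kpara_plus" if k: "k \<in> Kpara_plus" and h: "h \<in> Kpara_plus" for k h :: "'a^4^4"
  proof -
    have "(k ** h) *v x - x \<in> coord_lattice e"
      if "k *v (h *v x) - h *v x \<in> coord_lattice e" "h *v x - x \<in> coord_lattice e" for x e
      using int_submodule_add[OF int_submodule_coord_lattice that] by (simp flip: matrix_vector_mul_assoc)
    then show ?thesis
      using k h subsetD[OF Kpara_plus_subset h] by (simp add: Kpara_plus_iff Kpara_iff mult_in_GSp4)
  qed
qed

text \<open>Against \<open>v\<close> in \<open>L0\<close>, vectors of \<open>L0\<close> pair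
  integrally and vectors of \<open>L1\<close> pair into \<open>\<pp>\<close>. The latter therefore
  move by elements of \<open>\<pp> L0 = L2\<close>, and only the action on \<open>L0/L1\<close> can
  be nontrivial.\<close>

lemma transvection_in_Kpara_0:
  assumes "v \<in> L0" "c \<in> int_ring"
  shows "transvection c v \<in> (Kpara :: ('a^4^4) set)"
    and "x \<in> L1 \<Longrightarrow> transvection c v *v x - x \<in> L2"
proof -
  have c: "c \<in> frac_ideal 0"
    using assms by (simp add: frac_ideal_0)
  have 0: "(c * form x v) *s v \<in> L0" if "x \<in> L0" for x
  proof -
    have "form x v \<in> frac_ideal 0"
      using that assms(1) by (rule form_in_frac_ideal) simp_all
    then have "c * form x v \<in> int_ring"
      using frac_ideal_mult[OF c, of "form x v" 0 0] by (simp add: frac_ideal_0)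
    then show ?thesis
      using assms(1) int_submodule_scale[OF int_submodule_coord_lattice] by blast
  qed
  have 1: "(c * form x v) *s v \<in> L2" if "x \<in> L1" for x
  proof -
    have "form x v \<in> frac_ideal 1"
      using that assms(1) by (rule form_in_frac_ideal) simp_all
    then have "c * form x v \<in> frac_ideal 1"
      using frac_ideal_mult[OF c, of "form x v" 1 1] by simp
    then show ?thesis
      using assms(1) by (auto simp: coord_lattice_def forall_4 intro: frac_ideal_mult)
  qed
  show "x \<in> L1 \<Longrightarrow> transvection c v *v x - x \<in> L2"
    using 1 by (simp add: transvection_apply)
  show "transvection c v \<in> Kpara"
    using 0 subsetD[OF lattice_chain(2) 1]
    by (auto simp: Kpara_iff transvection_apply intro: int_submodule_add[OF int_submodule_coord_lattice])
qed

text \<open>Against \<open>v\<close> in \<open>L1\<close>, all of \<open>L0\<close> pairs into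
  \<open>\<pp>\<close>, which leaves room for one \<open>w\<close> in the denominator. Vectors of
  \<open>L0\<close> move by elements of \<open>L1\<close>, so only the action on
  \<open>L1/L2\<close> can be nontrivial.\<close>

lemma transvection_in_Kpara_1:
  assumes "v \<in> L1" "c \<in> int_ring"
  shows "transvection (c / w) v \<in> (Kpara :: ('a^4^4) set)"
    and "x \<in> L0 \<Longrightarrow> transvection (c / w) v *v x - x \<in> L1"
proof -
  have "inverse w \<in> frac_ideal (-1)"
    using w_powi_in_frac_ideal[of "-1"] by (simp add: power_int_minus)
  then have c: "c / w \<in> frac_ideal (-1)"
    using frac_ideal_mult[of c 0 "inverse w" "-1" "-1"] assms by (simp add: frac_ideal_0 divide_inverse)
  have 0: "(c / w * form x v) *s v \<in> L1" if "x \<in> L0" for x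
  proof -
    have "form x v \<in> frac_ideal 1"
      using that assms(1) by (rule form_in_frac_ideal) simp_all
    then have "c / w * form x v \<in> int_ring"
      using frac_ideal_mult[OF c, of "form x v" 1 0] by (simp add: frac_ideal_0)
    then show ?thesis
      using assms(1) int_submodule_scale[OF int_submodule_coord_lattice] by blast
  qed
  show "x \<in> L0 \<Longrightarrow> transvection (c / w) v *v x - x \<in> L1"
    using 0 by (simp add: transvection_apply)
  show "transvection (c / w) v \<in> Kpara"
    using 0[OF subsetD[OF lattice_chain(1)]] subsetD[OF lattice_chain(1) 0]
    by (auto simp: Kpara_iff transvection_apply intro: int_submodule_add[OF int_submodule_coord_lattice])
qed

text \<open>Nondegeneracy on the plane \<open>L0/L1\<close>: coordinate 2 or 3 of \<open>v\<close>
  is a unit, and \<open>u\<close> is supported on the coordinate paired with it.\<close>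

lemma exists_dual_0:
  assumes "v \<in> L0" "v \<notin> L1"
  obtains u :: "'a^4" where "u \<in> L0" "form u v = 1"
proof (cases "v $ 3 \<in> frac_ideal 1")
  case False
  then have "v $ 3 \<noteq> 0" "1 / v $ 3 \<in> frac_ideal 0"
    using frac_ideal_divide[OF one_in_frac_ideal False] by auto
  then show ?thesis
    by (intro that[of "axis 2 (1 / v $ 3)"]) (simp_all add: coord_lattice_def forall_4 axis_def form_def)
next
  case True
  then have v2: "v $ 2 \<notin> frac_ideal 1"
    using assms by (simp add: coord_lattice_def forall_4)
  then have "v $ 2 \<noteq> 0" "1 / v $ 2 \<in> frac_ideal 0"
    using frac_ideal_divide[OF one_in_frac_ideal v2] by auto
  then show ?thesis
    by (intro that[of "axis 3 (- (1 / v $ 2))"])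
       (simp_all add: coord_lattice_def forall_4 axis_def form_def del: minus_divide_left)
qed

text \<open>Nondegeneracy on \<open>L1/L2\<close>, in coordinates 1 and 4. The target value is
  \<open>w\<close> because the form maps \<open>L1\<close> into \<open>\<pp>\<close>.\<close>

lemma exists_dual_1:
  assumes "v \<in> L1" "v \<notin> L2"
  obtains u :: "'a^4" where "u \<in> L1" "form u v = w"
proof (cases "v $ 4 \<in> frac_ideal 2")
  case False
  then have "v $ 4 \<noteq> 0" "w / v $ 4 \<in> frac_ideal 0"
    using frac_ideal_divide[OF w_in_frac_ideal False] by auto
  then show ?thesis
    by (intro that[of "axis 1 (w / v $ 4)"]) (simp_all add: coord_lattice_def forall_4 axis_def form_def)
next
  case True
  then have v1: "v $ 1 \<notin> frac_ideal 1"
    using assms by (simp add: coord_lattice_def forall_4)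
  then have "v $ 1 \<noteq> 0" "w / v $ 1 \<in> frac_ideal 1"
    using frac_ideal_divide[OF w_in_frac_ideal v1] by auto
  then show ?thesis
    by (intro that[of "axis 4 (- (w / v $ 1))"])
       (simp_all add: coord_lattice_def forall_4 axis_def form_def del: minus_divide_left)
qed

text \<open>On \<open>L0\<close>, modulo \<open>\<pp>\<close>, the form is the two by two
  determinant in coordinates 2 and 3. Its vanishing makes \<open>y\<close> proportional to
  \<open>v\<close> modulo \<open>L1\<close>, with the factor read off at a coordinate where
  \<open>v\<close> is a unit.\<close>

lemma isotropic_line_0:
  fixes v y :: "'a^4"
  assumes v: "v \<in> L0" "v \<notin> L1" and y: "y \<in> L0" and perp: "form y v \<in> frac_ideal 1"
  obtains c where "c \<in> int_ring" "y - c *s v \<in> L1"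
proof -
  have vi: "v $ 1 \<in> frac_ideal 0" "v $ 4 \<in> frac_ideal 1" and yi: "y $ 1 \<in> frac_ideal 0" "y $ 2 \<in> frac_ideal 0"
    "y $ 3 \<in> frac_ideal 0" "y $ 4 \<in> frac_ideal 1"
    using v y by (simp_all add: coord_lattice_def forall_4)
  have "form y v - y $ 1 * v $ 4 + y $ 4 * v $ 1 \<in> frac_ideal 1"
    using perp frac_ideal_mult[OF yi(1) vi(2)] frac_ideal_mult[OF yi(4) vi(1)]
    by (intro frac_ideal_add frac_ideal_diff) simp_all
  then have minor: "y $ 2 * v $ 3 - y $ 3 * v $ 2 \<in> frac_ideal 1"
    by (simp add: form_def algebra_simps)
  show ?thesis
  proof (cases "v $ 3 \<in> frac_ideal 1")
    case False
    then have "v $ 3 \<noteq> 0"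
      by auto
    let ?c = "y $ 3 / v $ 3"
    have c: "?c \<in> int_ring"
      using frac_ideal_divide[OF yi(3) False, of 0] by (simp add: frac_ideal_0)
    have "(y - ?c *s v) $ 2 = (y $ 2 * v $ 3 - y $ 3 * v $ 2) / v $ 3"
      using \<open>v $ 3 \<noteq> 0\<close> by (simp add: field_simps)
    then have "(y - ?c *s v) $ 2 \<in> frac_ideal 1"
      using frac_ideal_divide[OF minor False, of 1] by simp
    moreover have "y - ?c *s v \<in> L0"
      using int_submodule_coord_lattice y v(1) c by (intro int_submodule_diff int_submodule_scale)
    ultimately show ?thesis
      using that[OF c] \<open>v $ 3 \<noteq> 0\<close> by (simp add: coord_lattice_def forall_4)
  next
    case True
    then have v2: "v $ 2 \<notin> frac_ideal 1"
      using v by (simp add: coord_lattice_def forall_4)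
    then have "v $ 2 \<noteq> 0"
      by auto
    let ?c = "y $ 2 / v $ 2"
    have c: "?c \<in> int_ring"
      using frac_ideal_divide[OF yi(2) v2, of 0] by (simp add: frac_ideal_0)
    have "(y - ?c *s v) $ 3 = - ((y $ 2 * v $ 3 - y $ 3 * v $ 2) / v $ 2)"
      using \<open>v $ 2 \<noteq> 0\<close> by (simp add: field_simps)
    then have "(y - ?c *s v) $ 3 \<in> frac_ideal 1"
      using frac_ideal_divide[OF minor v2, of 1] by (simp only: frac_ideal_minus)
    moreover have "y - ?c *s v \<in> L0"
      using int_submodule_coord_lattice y v(1) c by (intro int_submodule_diff int_submodule_scale)
    ultimately show ?thesis
      using that[OF c] \<open>v $ 2 \<noteq> 0\<close> by (simp add: coord_lattice_def forall_4)
  qed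
qed

text \<open>The determinant argument in coordinates 1 and 4, modulo \<open>\<pp>^2\<close>, where
  products of coordinates 2 and 3 already lie. Fourth coordinates of \<open>L1\<close> start at
  \<open>\<pp>\<close>, hence the test of \<open>v $ 4\<close> against
  \<open>\<pp>^2\<close>.\<close>

lemma isotropic_line_1:
  fixes v y :: "'a^4"
  assumes v: "v \<in> L1" "v \<notin> L2" and y: "y \<in> L1" and perp: "form y v \<in> frac_ideal 2"
  obtains c where "c \<in> int_ring" "y - c *s v \<in> L2"
proof -
  have vi: "v $ 2 \<in> frac_ideal 1" "v $ 3 \<in> frac_ideal 1" and yi: "y $ 1 \<in> frac_ideal 0" "y $ 2 \<in> frac_ideal 1"
    "y $ 3 \<in> frac_ideal 1" "y $ 4 \<in> frac_ideal 1"
    using v y by (simp_all add: coord_lattice_def forall_4)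
  have "form y v - y $ 2 * v $ 3 + y $ 3 * v $ 2 \<in> frac_ideal 2"
    using perp frac_ideal_mult[OF yi(2) vi(2)] frac_ideal_mult[OF yi(3) vi(1)]
    by (intro frac_ideal_add frac_ideal_diff) simp_all
  then have minor: "y $ 1 * v $ 4 - y $ 4 * v $ 1 \<in> frac_ideal 2"
    by (simp add: form_def algebra_simps)
  show ?thesis
  proof (cases "v $ 4 \<in> frac_ideal 2")
    case False
    then have "v $ 4 \<noteq> 0"
      by auto
    let ?c = "y $ 4 / v $ 4"
    have c: "?c \<in> int_ring"
      using frac_ideal_divide[OF yi(4) False, of 0] by (simp add: frac_ideal_0)
    have "(y - ?c *s v) $ 1 = (y $ 1 * v $ 4 - y $ 4 * v $ 1) / v $ 4"
      using \<open>v $ 4 \<noteq> 0\<close> by (simp add: field_simps)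
    then have "(y - ?c *s v) $ 1 \<in> frac_ideal 1"
      using frac_ideal_divide[OF minor False, of 1] by simp
    moreover have "y - ?c *s v \<in> L1"
      using int_submodule_coord_lattice y v(1) c by (intro int_submodule_diff int_submodule_scale)
    ultimately show ?thesis
      using that[OF c] \<open>v $ 4 \<noteq> 0\<close> by (simp add: coord_lattice_def forall_4)
  next
    case True
    then have v1: "v $ 1 \<notin> frac_ideal 1"
      using v by (simp add: coord_lattice_def forall_4)
    then have "v $ 1 \<noteq> 0"
      by auto
    let ?c = "y $ 1 / v $ 1"
    have c: "?c \<in> int_ring"
      using frac_ideal_divide[OF yi(1) v1, of 0] by (simp add: frac_ideal_0)
    have "(y - ?c *s v) $ 4 = - ((y $ 1 * v $ 4 - y $ 4 * v $ 1) / v $ 1)"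
      using \<open>v $ 1 \<noteq> 0\<close> by (simp add: field_simps)
    then have "(y - ?c *s v) $ 4 \<in> frac_ideal 2"
      using frac_ideal_divide[OF minor v1, of 2] by (simp only: frac_ideal_minus)
    moreover have "y - ?c *s v \<in> L1"
      using int_submodule_coord_lattice y v(1) c by (intro int_submodule_diff int_submodule_scale)
    ultimately show ?thesis
      using that[OF c] \<open>v $ 1 \<noteq> 0\<close> by (simp add: coord_lattice_def forall_4)
  qed
qed

end

section \<open>Unipotent radicals consisting of transvections\<close>

context discrete_absv
begin

text \<open>For \<open>M = L0\<close>, \<open>k = 1\<close> with \<open>v\<close> outside
  \<open>L1\<close>, or \<open>M = L1\<close>, \<open>k = 2\<close> with \<open>v\<close> outside
  \<open>L2\<close>, this is the preimage of the line spanned by \<open>v\<close>: in a symplectic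
  plane a line is its own orthogonal complement.\<close>

definition perp :: "('a^4) set \<Rightarrow> int \<Rightarrow> 'a^4 \<Rightarrow> ('a^4) set" where
  "perp M k v = {y \<in> M. form y v \<in> frac_ideal k}"

lemma int_submodule_perp: "int_submodule M \<Longrightarrow> int_submodule (perp M k v)"
  using frac_ideal_mult[of _ 0 _ k k] frac_ideal_add
  by (auto simp: int_submodule_def perp_def form_linear frac_ideal_0 form_def[of 0])

text \<open>\<open>M\<close> is spanned by \<open>u\<close> and the \<open>perp\<close> of
  \<open>v\<close>. On the latter both maps are trivial modulo \<open>N\<close>, so \<open>k\<close>
  is determined by \<open>k *v u - u\<close>, which is \<open>c *s v\<close> modulo
  \<open>N\<close>; the transvection with coefficient \<open>c / w powi j\<close> moves
  \<open>u\<close> by exactly that.\<close>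

lemma trivial_mod_perp_eq_transvection:
  assumes M: "int_submodule M" and N: "int_submodule N" and u: "u \<in> M" "form u v = w powi j"
    and integral: "\<And>x. x \<in> M \<Longrightarrow> form x v \<in> frac_ideal j"
    and line: "\<And>y. y \<in> perp M (j + 1) v \<Longrightarrow> \<exists>c\<in>int_ring. y - c *s v \<in> N"
    and k: "trivial_on_quotient k M (perp M (j + 1) v)" "trivial_on_quotient k (perp M (j + 1) v) N"
  obtains c where "c \<in> int_ring" "\<And>x. x \<in> M \<Longrightarrow> k *v x - transvection (c / w powi j) v *v x \<in> N"
proof -
  have "k *v u - u \<in> perp M (j + 1) v"
    using k(1) u(1) by (simp add: trivial_on_quotient_def)
  then obtain c where c: "c \<in> int_ring" "k *v u - u - c *s v \<in> N"
    using line by blast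
  have "k *v x - transvection (c / w powi j) v *v x \<in> N" if x: "x \<in> M" for x
  proof -
    \<comment> \<open>The coordinate of \<open>x\<close> along \<open>u\<close>: the remainder
      \<open>x - a *s u\<close> pairs to 0 with \<open>v\<close>.\<close>
    define a where "a = form x v / w powi j"
    have form_x: "form x v = a * w powi j"
      using w_nonzero by (simp add: a_def)
    have "form x v * w powi (- j) \<in> frac_ideal 0"
      using integral[OF x] w_powi_in_frac_ideal by (rule frac_ideal_mult) simp
    then have a: "a \<in> int_ring"
      by (simp add: a_def power_int_minus divide_inverse frac_ideal_0)
    have "x - a *s u \<in> perp M (j + 1) v"
      using x u a M form_x by (simp add: perp_def form_linear int_submodule_diff int_submodule_scale)
    then have "k *v (x - a *s u) - (x - a *s u) \<in> N"
      using k(2) by (simp add: trivial_on_quotient_def)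
    then have "a *s (k *v u - u - c *s v) + (k *v (x - a *s u) - (x - a *s u)) \<in> N"
      using N a c(2) by (intro int_submodule_add int_submodule_scale)
    moreover have "a *s (k *v u - u - c *s v) + (k *v (x - a *s u) - (x - a *s u)) =
        k *v x - transvection (c / w powi j) v *v x"
      using w_nonzero form_x
      by (simp add: transvection_apply vec.diff vector_scale_linear vector_ssub_ldistrib
          vector_sadd_rdistrib mult.commute)
    ultimately show ?thesis
      by simp
  qed
  with c(1) show ?thesis
    by (rule that)
qed

section \<open>Cosets of \<open>Kpara_plus\<close> and proper parabolics\<close>

lemma rcoset_Kpara_plus_eq:
  assumes k: "k \<in> Kpara" and h: "h \<in> (Kpara :: ('a^4^4) set)"
    and "\<And>x. x \<in> L0 \<Longrightarrow> k *v x - h *v x \<in> L1" "\<And>x. x \<in> L1 \<Longrightarrow> k *v x - h *v x \<in> L2"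
  shows "Kpara_plus #>\<^bsub>GSp4\<^esub> k = Kpara_plus #>\<^bsub>GSp4\<^esub> h"
proof -
  have G: "k \<in> carrier GSp4" "h \<in> carrier GSp4"
    using k h by (simp_all add: Kpara_iff)
  have "k = (k ** inv\<^bsub>GSp4\<^esub> h) ** h"
    by (simp add: inv_GSp4 G flip: matrix_mul_assoc)
  then have "k \<in> Kpara_plus #>\<^bsub>GSp4\<^esub> h"
    using Kpara_plus_divI[OF assms] by (force simp: r_coset_def)
  then show ?thesis
    using GSp4.repr_independence[OF _ G(2) subgroup_Kpara_plus] by simp
qed

text \<open>Elements of \<open>Kpara_plus\<close> move vectors of \<open>A\<close> by
  \<open>L1\<close> and vectors of \<open>B\<close> by \<open>L2\<close>, so they preserve both.
  Hence every representative of a coset in \<open>parabolic A B\<close> maps \<open>A\<close> and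
  \<open>B\<close> into themselves, and the coset of \<open>k\<close> is not among them.\<close>

lemma parabolic_proper:
  assumes flag: "flag_pair A B" and k: "k \<in> (Kpara :: ('a^4^4) set)"
    and moves: "(\<exists>y\<in>A. k *v y \<notin> A) \<or> (\<exists>y\<in>B. k *v y \<notin> B)"
  shows "parabolic A B \<noteq> carrier Kquot"
proof
  assume "parabolic A B = carrier Kquot"
  moreover have "Kpara_plus #>\<^bsub>GSp4\<^esub> k \<in> carrier Kquot"
    using k by (auto simp: FactGroup_def RCOSETS_def r_coset_def)
  ultimately obtain h where h: "h \<in> Kpara" "(*v) h ` A = A" "(*v) h ` B = B"
    and eq: "Kpara_plus #>\<^bsub>GSp4\<^esub> k = Kpara_plus #>\<^bsub>GSp4\<^esub> h"
    unfolding parabolic_def by blast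
  have "k \<in> Kpara_plus #>\<^bsub>GSp4\<^esub> k"
    using k subgroup_Kpara_plus by (intro GSp4.rcos_self) (simp_all add: Kpara_iff)
  then obtain n where n: "n \<in> Kpara_plus" and kn: "k = n ** h"
    unfolding eq by (auto simp: r_coset_def)
  have "n *v y \<in> A" if "y \<in> A" for y
  proof -
    have "y \<in> L0" using flag that by (auto simp: flag_pair_def)
    then have "n *v y - y \<in> A" using n flag by (auto simp: Kpara_plus_iff flag_pair_def)
    then show ?thesis
      using int_submodule_add[of A "n *v y - y" y] flag that by (simp add: flag_pair_def)
  qed
  moreover have "n *v y \<in> B" if "y \<in> B" for y
  proof -
    have "y \<in> L1" using flag that by (auto simp: flag_pair_def)
    then have "n *v y - y \<in> B" using n flag by (auto simp: Kpara_plus_iff flag_pair_def)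
    then show ?thesis
      using int_submodule_add[of B "n *v y - y" y] flag that by (simp add: flag_pair_def)
  qed
  moreover have "h *v y \<in> A" if "y \<in> A" for y using h that by blast
  moreover have "h *v y \<in> B" if "y \<in> B" for y using h that by blast
  ultimately show False
    using moves by (auto simp: kn simp flip: matrix_vector_mul_assoc)
qed

lemma cuspidal_fixed_zero:
  fixes \<sigma> :: "('a^4^4) set \<Rightarrow> 'w::ab_group_add \<Rightarrow> 'w"
  assumes "cuspidal smul \<sigma>" "flag_pair A B" "parabolic A B \<noteq> carrier Kquot"
    and "\<And>U. U \<in> unipotent_radical A B \<Longrightarrow> \<sigma> U x = x"
  shows "x = 0"
proof -
  have "x \<in> fixed_vectors UNIV \<sigma> (unipotent_radical A B)"
    using assms(4) by (simp add: fixed_vectors_def)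
  then show ?thesis
    using assms(1-3) unfolding cuspidal_def by blast
qed

text \<open>The transvection sends \<open>v\<close> to \<open>v - u\<close>, and the value
  \<open>w powi j\<close> of \<open>form u v\<close> just fails to lie in
  \<open>\<pp>^(j+1)\<close>. This supplies the element that makes the parabolic proper.\<close>

lemma transvection_moves_perp:
  assumes v: "v \<in> M" and u: "form u v = w powi j"
  shows "v \<in> perp M (j + 1) v" "transvection (1 / w powi j) u *v v \<notin> perp M (j + 1) v"
proof -
  have "form v u = - (w powi j)"
    using u form_swap[of v u] by simp
  then have "transvection (1 / w powi j) u *v v = v - u"
    using w_nonzero by (simp add: transvection_apply)
  moreover have "w powi j \<notin> frac_ideal (j + 1)"
    using absv_w_powi_le_iff[of j "j + 1"] by (simp add: frac_ideal_iff absv_powi)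
  ultimately show "transvection (1 / w powi j) u *v v \<notin> perp M (j + 1) v"
    by (simp add: perp_def form_linear u)
  show "v \<in> perp M (j + 1) v"
    using v by (simp add: perp_def)
qed

text \<open>The parabolic stabilises the line of \<open>v\<close> in \<open>L0/L1\<close>, with the
  trivial choice \<open>B = L1\<close> for the other plane. Each coset in its unipotent radical
  contains a transvection along \<open>v\<close>, so the assumed invariance covers the whole
  radical.\<close>

lemma cuspidal_transvections_0:
  fixes \<sigma> :: "('a^4^4) set \<Rightarrow> 'w::ab_group_add \<Rightarrow> 'w"
  assumes cusp: "cuspidal smul \<sigma>" and v: "v \<in> L0" "v \<notin> L1"
    and fixed: "\<And>c. c \<in> int_ring \<Longrightarrow> \<sigma> (Kpara_plus #>\<^bsub>GSp4\<^esub> transvection c v) x = x"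
  shows "x = 0"
proof -
  obtain u where u: "u \<in> L0" "form u v = 1"
    using exists_dual_0[OF v] .
  let ?A = "perp L0 1 v"
  have flag: "flag_pair ?A L1"
    unfolding flag_pair_def
  proof (intro conjI)
    show "L1 \<subseteq> ?A"
      using lattice_chain L1_dual v(1) by (auto simp: perp_def)
  qed (use lattice_chain in \<open>auto simp: perp_def int_submodule_coord_lattice int_submodule_perp[unfolded perp_def]\<close>)
  have "transvection 1 u \<in> Kpara"
    using transvection_in_Kpara_0(1)[OF u(1), of 1] by (simp add: mem_int_ring)
  moreover have "v \<in> ?A" "transvection 1 u *v v \<notin> ?A"
    using transvection_moves_perp[of v L0 u 0] v u by simp_all
  ultimately have "parabolic ?A L1 \<noteq> carrier Kquot"
    using flag by (intro parabolic_proper) blast+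
  with cusp flag show ?thesis
  proof (rule cuspidal_fixed_zero)
    fix U assume "U \<in> unipotent_radical ?A L1"
    then obtain k where U: "U = Kpara_plus #>\<^bsub>GSp4\<^esub> k" and K: "k \<in> Kpara"
      and k: "trivial_on_quotient k L0 ?A" "trivial_on_quotient k ?A L1" "trivial_on_quotient k L1 L2"
      by (auto simp: unipotent_radical_def)
    obtain c where c: "c \<in> int_ring"
      and approx: "\<And>x. x \<in> L0 \<Longrightarrow> k *v x - transvection c v *v x \<in> L1"
    proof (rule trivial_mod_perp_eq_transvection[of L0 L1 u v 0 k])
      show "form x v \<in> frac_ideal 0" if "x \<in> L0" for x
        using that v(1) by (rule form_in_frac_ideal) simp_all
      show "\<exists>c\<in>int_ring. y - c *s v \<in> L1" if "y \<in> perp L0 (0 + 1) v" for y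
        using isotropic_line_0[OF v, of y] that by (auto simp: perp_def)
    qed (use k u in \<open>auto simp: int_submodule_coord_lattice\<close>)
    \<comment> \<open>Both maps are trivial on \<open>L1/L2\<close>: \<open>k\<close> because
      \<open>B = L1\<close>, the transvection because \<open>v\<close> lies in
      \<open>L0\<close>.\<close>
    have "k *v x - transvection c v *v x \<in> L2" if "x \<in> L1" for x
    proof -
      have "k *v x - x \<in> L2"
        using k(3) that by (simp add: trivial_on_quotient_def)
      then have "(k *v x - x) - (transvection c v *v x - x) \<in> L2"
        using transvection_in_Kpara_0(2)[OF v(1) c that]
        by (rule int_submodule_diff[OF int_submodule_coord_lattice])
      then show ?thesis
        by simp
    qed
    then have "U = Kpara_plus #>\<^bsub>GSp4\<^esub> transvection c v"
      unfolding U using K approx transvection_in_Kpara_0(1)[OF v(1) c] by (intro rcoset_Kpara_plus_eq)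
    then show "\<sigma> U x = x"
      using fixed[OF c] by simp
  qed
qed

text \<open>The mirror case: the line of \<open>v\<close> in \<open>L1/L2\<close>, with
  \<open>A = L0\<close>. As the form maps \<open>L1\<close> into \<open>\<pp>\<close>, the argument
  with \<open>perp\<close> runs with \<open>j = 1\<close>, which puts \<open>w\<close> in the
  denominator.\<close>

lemma cuspidal_transvections_1:
  fixes \<sigma> :: "('a^4^4) set \<Rightarrow> 'w::ab_group_add \<Rightarrow> 'w"
  assumes cusp: "cuspidal smul \<sigma>" and v: "v \<in> L1" "v \<notin> L2"
    and fixed: "\<And>c. c \<in> int_ring \<Longrightarrow> \<sigma> (Kpara_plus #>\<^bsub>GSp4\<^esub> transvection (c / w) v) x = x"
  shows "x = 0"
proof -
  obtain u where u: "u \<in> L1" "form u v = w"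
    using exists_dual_1[OF v] .
  let ?B = "perp L1 2 v"
  have flag: "flag_pair L0 ?B"
    unfolding flag_pair_def
  proof (intro conjI)
    have "form x v \<in> frac_ideal 2" if "x \<in> L2" for x
      using that v(1) by (rule form_in_frac_ideal) simp_all
    then show "L2 \<subseteq> ?B"
      using lattice_chain by (auto simp: perp_def)
  qed (use lattice_chain in \<open>auto simp: perp_def int_submodule_coord_lattice int_submodule_perp[unfolded perp_def]\<close>)
  have "transvection (1 / w) u \<in> Kpara"
    using transvection_in_Kpara_1(1)[OF u(1), of 1] by (simp add: mem_int_ring)
  moreover have "v \<in> ?B" "transvection (1 / w) u *v v \<notin> ?B"
    using transvection_moves_perp[of v L1 u 1] v u by simp_all
  ultimately have "parabolic L0 ?B \<noteq> carrier Kquot"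
    using flag by (intro parabolic_proper) blast+
  with cusp flag show ?thesis
  proof (rule cuspidal_fixed_zero)
    fix U assume "U \<in> unipotent_radical L0 ?B"
    then obtain k where U: "U = Kpara_plus #>\<^bsub>GSp4\<^esub> k" and K: "k \<in> Kpara"
      and k: "trivial_on_quotient k L1 ?B" "trivial_on_quotient k ?B L2" "trivial_on_quotient k L0 L1"
      by (auto simp: unipotent_radical_def)
    obtain c where c: "c \<in> int_ring"
      and approx: "\<And>x. x \<in> L1 \<Longrightarrow> k *v x - transvection (c / w) v *v x \<in> L2"
    proof (rule trivial_mod_perp_eq_transvection[of L1 L2 u v 1 k])
      show "form x v \<in> frac_ideal 1" if "x \<in> L1" for x
        using that v(1) by (rule form_in_frac_ideal) simp_all
      show "\<exists>c\<in>int_ring. y - c *s v \<in> L2" if "y \<in> perp L1 (1 + 1) v" for y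
        using isotropic_line_1[OF v, of y] that by (auto simp: perp_def)
    qed (use k u in \<open>auto simp: int_submodule_coord_lattice\<close>)
    have "k *v x - transvection (c / w) v *v x \<in> L1" if "x \<in> L0" for x
    proof -
      have "k *v x - x \<in> L1"
        using k(3) that by (simp add: trivial_on_quotient_def)
      then have "(k *v x - x) - (transvection (c / w) v *v x - x) \<in> L1"
        using transvection_in_Kpara_1(2)[OF v(1) c that]
        by (rule int_submodule_diff[OF int_submodule_coord_lattice])
      then show ?thesis
        by simp
    qed
    then have "U = Kpara_plus #>\<^bsub>GSp4\<^esub> transvection (c / w) v"
      unfolding U using K approx transvection_in_Kpara_1(1)[OF v(1) c] by (intro rcoset_Kpara_plus_eq)
    then show "\<sigma> U x = x"
      using fixed[OF c] by simp
  qed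
qed

end

section \<open>Vanishing of the fixed vectors\<close>

context discrete_absv
begin

text \<open>Since \<open>L2\<close> is \<open>w\<close> times \<open>L0\<close>, it suffices to
  divide by the largest power of \<open>w\<close> that leaves the vector in
  \<open>L0\<close>.\<close>

lemma primitive_multiple:
  assumes "(v :: 'a^4) \<noteq> 0"
  obtains k v' where "v = w powi k *s v'" "v' \<in> L0" "v' \<notin> L2"
proof -
  define e where "e = (vector [0, 0, 0, 1] :: int^4)"
  have "\<exists>m. v $ i \<noteq> 0 \<longrightarrow> absv (v $ i) = absv w powi m" for i
    using absv_eq_w_powi by metis
  then obtain m where m: "\<And>i. v $ i \<noteq> 0 \<Longrightarrow> absv (v $ i) = absv w powi m i"
    by metis
  \<comment> \<open>Valuations of the nonzero coordinates relative to the exponents of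
    \<open>L0\<close>. The minimum is attained, and at that coordinate the rescaled vector escapes
    \<open>L2\<close>.\<close>
  define S where "S = (\<lambda>i. m i - e $ i) ` {i. v $ i \<noteq> 0}"
  have "finite S" "S \<noteq> {}"
    using assms by (auto simp: S_def vec_eq_iff)
  define k where "k = Min S"
  have "k \<in> S"
    using \<open>finite S\<close> \<open>S \<noteq> {}\<close> by (simp add: k_def)
  then obtain i where i: "v $ i \<noteq> 0" "m i = k + e $ i"
    by (auto simp: S_def)
  have le: "k \<le> m j - e $ j" if "v $ j \<noteq> 0" for j
    using that \<open>finite S\<close> by (auto simp: k_def S_def)
  define v' where "v' = w powi (- k) *s v"
  have mem: "v' $ j \<in> frac_ideal l \<longleftrightarrow> v $ j = 0 \<or> l \<le> m j - k" for j l
  proof (cases "v $ j = 0")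
    case False
    then have "absv (v' $ j) = absv w powi (m j - k)"
      using w_nonzero by (simp add: v'_def absv_mult absv_powi absv_inverse m power_int_diff power_int_minus divide_inverse)
    then show ?thesis
      using False by (simp add: frac_ideal_iff absv_w_powi_le_iff)
  qed (simp add: v'_def)
  show ?thesis
  proof
    show "v = w powi k *s v'"
      using w_nonzero by (simp add: v'_def power_int_minus)
    show "v' \<in> L0"
      using le by (auto simp: coord_lattice_def mem e_def[symmetric] algebra_simps)
    have "vector [1, 1, 1, 2] $ i = e $ i + 1"
      using exhaust_4[of i] by (auto simp: e_def)
    then have "v' $ i \<notin> frac_ideal (vector [1, 1, 1, 2] $ i)"
      using i by (simp add: mem)
    then show "v' \<notin> L2"
      by (auto simp: coord_lattice_def)
  qed
qed

text \<open>Apart from the identity the matrix has one entry, at position (2,3) or (3,2), where the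
  Klingen pattern allows all of \<oo> for every \<open>n\<close>.\<close>

lemma transvection_in_Klingen:
  assumes "c \<in> int_ring" "e = axis 2 1 \<or> e = axis 3 1"
  shows "transvection c e \<in> (Klingen n :: ('a^4^4) set)"
proof -
  have "c \<in> frac_ideal 0"
    using assms(1) by (simp add: frac_ideal_0)
  then have "transvection c e \<in> entries_in (vector [vector [0, 0, 0, 0], vector [int n, 0, 0, 0],
      vector [int n, 0, 0, 0], vector [int n, int n, int n, 0]])"
    using assms(2) by (auto simp: entries_in_def forall_4 transvection_def form_def axis_def)
  then show ?thesis
    by (simp add: Klingen_def GSp4_0_def int_units_iff)
qed

text \<open>
  Of the columns \<open>g e\<^sub>2\<close> and \<open>g e\<^sub>3\<close>, whose form is the multiplier of \<open>g\<close>, the one of smaller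
  valuation works.
\<close>

lemma exists_short_column:
  fixes g :: "'a^4^4"
  assumes g: "g \<in> carrier GSp4"
  obtains e k v where "e = axis 2 1 \<or> e = axis 3 1" "g *v e = w powi k *s v" "v \<in> L0" "v \<notin> L2"
    "multiplier g \<in> frac_ideal (2 * k)" "v \<in> L1 \<longrightarrow> multiplier g \<in> frac_ideal (2 * k + 1)"
proof -
  have nonzero: "g *v axis i 1 \<noteq> 0" for i :: 4
  proof
    assume "g *v axis i 1 = 0"
    then have "axis i (1 :: 'a) = 0"
      using inv_GSp4_cancel(1)[OF g, of "axis i 1"] by simp
    then show False
      by (simp add: axis_eq_0_iff)
  qed
  obtain k2 v2 where 2: "g *v axis 2 1 = w powi k2 *s v2" "v2 \<in> L0" "v2 \<notin> L2"
    using primitive_multiple[OF nonzero] .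
  obtain k3 v3 where 3: "g *v axis 3 1 = w powi k3 *s v3" "v3 \<in> L0" "v3 \<notin> L2"
    using primitive_multiple[OF nonzero] .
  have "multiplier g = form (w powi k2 *s v2) (w powi k3 *s v3)"
    using form_GSp4[OF g, of "axis 2 1" "axis 3 1"] 2 3 by simp
  also have "\<dots> = w powi (k2 + k3) * form v2 v3"
    using w_nonzero by (simp add: form_linear power_int_add mult_ac)
  finally have mult: "multiplier g = w powi (k2 + k3) * form v2 v3" .
  have bound: "multiplier g \<in> frac_ideal l" if "form v2 v3 \<in> frac_ideal j" "l \<le> k2 + k3 + j" for l j
    unfolding mult using w_powi_in_frac_ideal that by (rule frac_ideal_mult)
  have form0: "form v2 v3 \<in> frac_ideal 0"
    using 2(2) 3(2) by (rule form_in_frac_ideal) simp_all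
  have form1: "form v2 v3 \<in> frac_ideal 1" if "v2 \<in> L1 \<or> v3 \<in> L1"
    using that
  proof
    assume "v2 \<in> L1" then show ?thesis using 3(2) by (rule form_in_frac_ideal) simp_all
  next
    assume "v3 \<in> L1" with 2(2) show ?thesis by (rule form_in_frac_ideal) simp_all
  qed
  show ?thesis
  \<comment> \<open>Taking the smaller exponent as \<open>k\<close> gives
    \<open>2 * k \<le> k2 + k3\<close>, as \<open>bound\<close> requires.\<close>
  proof (cases "k2 \<le> k3")
    case True
    then show ?thesis
      using that[of "axis 2 1" k2 v2] 2 bound[OF form0, of "2 * k2"] bound[OF form1, of "2 * k2 + 1"] by simp
  next
    case False
    then show ?thesis
      using that[of "axis 3 1" k3 v3] 3 bound[OF form0, of "2 * k3"] bound[OF form1, of "2 * k3 + 1"] by simp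
  qed
qed

text \<open>The pointwise core: left equivariance under \<open>Kpara\<close> and right invariance
  under \<open>Klingen n\<close> are combined at a single \<open>g\<close>.\<close>

lemma Klingen_invariant_zero:
  fixes \<sigma> :: "('a^4^4) set \<Rightarrow> 'w::ab_group_add \<Rightarrow> 'w"
  assumes cusp: "cuspidal smul \<sigma>" and g: "g \<in> carrier GSp4"
    and left: "\<And>k. k \<in> Kpara \<Longrightarrow> f (k ** g) = \<sigma> (Kpara_plus #>\<^bsub>GSp4\<^esub> k) (f g)"
    and right: "\<And>u. u \<in> Klingen n \<Longrightarrow> f (g ** u) = f g"
  shows "f g = 0"
proof -
  obtain e k v where e: "e = axis 2 1 \<or> e = axis 3 1" and ge: "g *v e = w powi k *s v"
    and v: "v \<in> L0" "v \<notin> L2" and m: "multiplier g \<in> frac_ideal (2 * k)"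
      "v \<in> L1 \<longrightarrow> multiplier g \<in> frac_ideal (2 * k + 1)"
    by (rule exists_short_column[OF g])
  \<comment> \<open>Left translation by a transvection along \<open>v\<close> is right translation
    by one along \<open>e\<close>. Condition \<open>c\<close> says exactly that the conjugated
    coefficient is integral; \<open>2 * k\<close> comes from squaring the scale
    \<open>w powi k\<close>.\<close>
  have fixed: "\<sigma> (Kpara_plus #>\<^bsub>GSp4\<^esub> transvection c v) (f g) = f g"
    if K: "transvection c v \<in> Kpara" and c: "c * multiplier g \<in> frac_ideal (2 * k)" for c
  proof -
    let ?c = "c * multiplier g / (w powi k)\<^sup>2"
    have "(w powi k)\<^sup>2 = w powi (2 * k)"
      unfolding power2_eq_square mult_2 using w_nonzero by (intro power_int_add[symmetric]) simp
    then have "?c = c * multiplier g * w powi (- (2 * k))"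
      by (simp add: power_int_minus divide_inverse)
    also have "\<dots> \<in> int_ring"
      unfolding frac_ideal_0[symmetric] using c w_powi_in_frac_ideal by (rule frac_ideal_mult) simp
    finally have "transvection ?c e \<in> Klingen n"
      using e by (rule transvection_in_Klingen)
    then have "f (g ** transvection ?c e) = f g"
      by (rule right)
    moreover have "transvection c v ** g = g ** transvection ?c e"
      using g ge w_nonzero by (intro transvection_conj) simp_all
    ultimately show ?thesis
      using left[OF K] by simp
  qed
  show ?thesis
  \<comment> \<open>\<open>v\<close> spans a line in \<open>L0/L1\<close> or in
    \<open>L1/L2\<close>. In the second case the additional factor from \<pp> in the multiplier pays
    for the denominator \<open>w\<close>.\<close>
  proof (cases "v \<in> L1")
    case False
    show ?thesis
      using cusp v(1) False
    proof (rule cuspidal_transvections_0)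
      fix c :: 'a assume c: "c \<in> int_ring"
      then have "c * multiplier g \<in> frac_ideal (2 * k)"
        using frac_ideal_mult[OF _ m(1), of c 0] by (simp add: frac_ideal_0)
      with transvection_in_Kpara_0(1)[OF v(1) c]
      show "\<sigma> (Kpara_plus #>\<^bsub>GSp4\<^esub> transvection c v) (f g) = f g"
        by (rule fixed)
    qed
  next
    case True
    show ?thesis
      using cusp True v(2)
    proof (rule cuspidal_transvections_1)
      fix c :: 'a assume c: "c \<in> int_ring"
      have "c * w powi (-1) \<in> frac_ideal (-1)"
        using c by (intro frac_ideal_mult[of c 0 _ "-1"]) (simp_all only: frac_ideal_0 w_powi_in_frac_ideal add_0 order_refl)
      then have "c / w * multiplier g \<in> frac_ideal (2 * k)"
        using frac_ideal_mult[OF _ m(2)[rule_format, OF True], of "c / w" "-1"]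
        by (simp add: power_int_minus divide_inverse)
      with transvection_in_Kpara_1(1)[OF True c]
      show "\<sigma> (Kpara_plus #>\<^bsub>GSp4\<^esub> transvection (c / w) v) (f g) = f g"
        by (rule fixed)
    qed
  qed
qed

end

section \<open>Passage from a finite extension of the \<open>p\<close>-adic numbers to the
  discretely valued setting\<close>

theorem theorem3p1:
  fixes p :: nat
    and smul :: "complex \<Rightarrow> 'w::ab_group_add \<Rightarrow> 'w"
    and \<tau> :: "'a::{field_char_0, metric_space}^4^4 \<Rightarrow> 'w \<Rightarrow> 'w"
    and \<sigma> :: "('a^4^4) set \<Rightarrow> 'w \<Rightarrow> 'w"
  assumes "finite_extension_of_Qp p TYPE('a)"
    and "irreducible_representation smul Knormalizer \<tau>"
    and "cuspidal smul \<sigma>"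
    and "\<forall>k\<in>Kpara. \<tau> k = \<sigma> (Kpara_plus #>\<^bsub>GSp4\<^esub> k)"
  shows "\<forall>n. fixed_vectors (c_Ind GSp4 (normalizer GSp4 Kpara) \<tau>)
               (right_translation GSp4) (Klingen n) = {\<lambda>_. 0}"
proof (intro allI equalityI subsetI)
  fix n
  from assms(1) interpret nonarch_absv "TYPE('a)"
    by unfold_locales (simp_all add: finite_extension_of_Qp_def)
  from assms(1) obtain B :: "'a set" where p: "prime p" "absv (of_nat p :: 'a) = 1 / real p" and B: "finite B"
    "\<And>x :: 'a. \<exists>c. (\<forall>b\<in>B. c b \<in> closure \<rat>) \<and> x = (\<Sum>b\<in>B. c b * b)"
    unfolding finite_extension_of_Qp_def by blast
  obtain w :: 'a where w: "w \<noteq> 0" "absv w < 1" "\<forall>x :: 'a. absv x < 1 \<longrightarrow> absv x \<le> absv w"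
    by (rule exists_uniformizer[OF p B])
  interpret discrete_absv w
    by unfold_locales (use w in auto)
  show "f \<in> {\<lambda>_. 0}"
    if f: "f \<in> fixed_vectors (c_Ind GSp4 (normalizer GSp4 Kpara) \<tau>) (right_translation GSp4) (Klingen n)" for f
  proof -
    \<comment> \<open>As \<open>Kpara\<close> lies in its normaliser, the equivariance of
      \<open>f\<close> restricts to it, and there \<open>\<tau>\<close> is inflated from
      \<open>\<sigma>\<close>.\<close>
    have "Kpara \<subseteq> normalizer GSp4 (Kpara :: ('a^4^4) set)"
      using subgroup.subset[OF normal_imp_subgroup[OF GSp4.subgroup_in_normalizer[OF subgroup_Kpara]]] by simp
    moreover have "f (h \<otimes>\<^bsub>GSp4\<^esub> g) = \<tau> h (f g)" if "h \<in> normalizer GSp4 Kpara" "g \<in> carrier GSp4" for h g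
      using f that unfolding fixed_vectors_def c_Ind_def by blast
    ultimately have left: "f (k ** g) = \<sigma> (Kpara_plus #>\<^bsub>GSp4\<^esub> k) (f g)"
      if "k \<in> Kpara" "g \<in> carrier GSp4" for k g
      using assms(4) that by fastforce
    have "right_translation GSp4 u f = f" if "u \<in> Klingen n" for u
      using f that by (simp add: fixed_vectors_def)
    then have right: "f (g ** u) = f g" if "u \<in> Klingen n" "g \<in> carrier GSp4" for u g
      using that by (metis mult_GSp4 right_translation_def)
    have "f g = 0" for g
    proof (cases "g \<in> carrier GSp4")
      case True
      with assms(3) show ?thesis
        by (rule Klingen_invariant_zero) (use True left right in auto)
    next
      case False
      then show ?thesis
        using f by (simp add: fixed_vectors_def c_Ind_def)
    qed
    then show ?thesis
      by auto
  qed
  show "f \<in> fixed_vectors (c_Ind GSp4 (normalizer GSp4 Kpara) \<tau>) (right_translation GSp4) (Klingen n)"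
    if "f \<in> {\<lambda>_. 0}" for f
  proof -
    \<comment> \<open>Linearity gives \<open>\<tau> h 0 = 0\<close>, which is the equivariance of
      the zero function. Its invariance group is all of \<open>GSp4\<close> and its support is
      covered by the empty compact set.\<close>
    have "Vector_Spaces.linear smul smul (\<tau> h)" if "h \<in> normalizer GSp4 Kpara" for h
      using assms(2) that by (simp add: irreducible_representation_def representation_def)
    then have "\<tau> h 0 = 0" if "h \<in> normalizer GSp4 Kpara" for h
      using that module_hom.zero by (metis linear_iff_module_hom)
    then have "(\<lambda>_. 0) \<in> c_Ind GSp4 (normalizer GSp4 Kpara) \<tau>"
      unfolding c_Ind_def mem_Collect_eq
      by (intro conjI exI[of _ "carrier GSp4"] exI[of _ "{}"]) (simp_all add: GSp4.subgroup_self)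
    then show ?thesis
      using that by (auto simp: fixed_vectors_def right_translation_def)
  qed
qed

end
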